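(* Let $k$ be a commutative ring, $\mathcal B$ a $k$-category and $b_0$ an object of $\mathcal B$. Let $F_1:\mathcal B\#G_1\to\mathcal B$ and $F_2:\mathcal B\#G_2\to\mathcal B$ be the Galois coverings associated to connected gradings $X_1$ and $X_2$ of $\mathcal B$ by groups $G_1$ and $G_2$. Let $(H,J):F_1\to F_2$ be a morphism in $\mathsf{Gal}(\mathcal B,b_0)$. Then there exists a map $h:G_1\to G_2$ such that $H(b_0,g)=(b_0,h(g))$ for all $g\in G_1$. Moreover, $h$ is a morphism of $G_1$-sets (where $G_1$ acts on itself by left multiplication and on $G_2$ by left multiplication through $\lambda_H$), and $h(g)=\lambda_H(g)h(1)$ for all $g\in G_1$, where $\lambda_H:G_1\to G_2$ is the group morphism associated to $H$.
   Context: A $k$-category is a small category $\mathcal B$ whose morphism sets ${}_y\mathcal B_x$ (from $x$ to $y$) are $k$-modules with $k$-bilinear composition. It is connected if any two objects are joined by a non-zero walk, i.e. a finite composable sequence $(f_n,\epsilon_n)\cdots(f_1,\epsilon_1)$ of non-zero morphisms with signs $\epsilon_i=\pm1$ (sign $-1$ means that source and target are exchanged). A grading $X$ of $\mathcal B$ by a group $G$ is a decomposition ${}_y\mathcal B_x=\bigoplus_{s\in G}X^s({}_y\mathcal B_x)$ with $X^t({}_z\mathcal B_y)X^s({}_y\mathcal B_x)\subset X^{ts}({}_z\mathcal B_x)$. A walk of non-zero homogeneous morphisms has degree $(\deg f_n)^{\epsilon_n}\cdots(\deg f_1)^{\epsilon_1}$; the grading is connected if any two objects can be joined by a non-zero homogeneous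 walk of any prescribed degree $g\in G$. The smash product category $\mathcal B\#G$ has objects $\mathcal B_0\times G$; the morphisms from $(b,g)$ to $(c,h)$ are $X^{h^{-1}g}({}_c\mathcal B_b)$; composition is that of $\mathcal B$. The functor $\mathcal B\#G\to\mathcal B$ given by $(b,g)\mapsto b$ and by inclusion on morphisms is, for a connected grading, a Galois covering. The group $G$ acts on $\mathcal B\#G$ by $u\cdot(b,g)=(b,ug)$ (a morphism from $(b,g)$ to $(c,h)$ is also one from $(b,ug)$ to $(c,uh)$), and this identifies $G$ with $\mathsf{Aut}_1$ of this covering. The star $\mathsf{St}_b\mathcal B$ is the direct sum of all morphism modules with source $b$ and all morphism modules with target $b$. A covering is a $k$-functor $F:\mathcal C\to\mathcal B$, surjective on objects, inducing a $k$-isomorphism $\mathsf{St}_x\mathcal C\to\mathsf{St}_{b}\mathcal B$ for each object $b$ of $\mathcal B$ and each $x\in F^{-1}(b)$. $\mathsf{Aut}_1F$ is the group of invertible endofunctors $G$ of $\mathcal C$ with $FG=F$. $F$ is a Galois covering if $\mathcal C$ is connected and $\mathsf{Aut}_1F$ acts transitively on some fibre. $\mathsf{Gal}(\mathcal B,b_0)$ is the category whose objects are the Galois coverings of $\mathcal B$, and whose morphisms from $F_1:\mathcal C_1\to\mathcal B$ to $F_2:\mathcal C_2\to\mathcal B$ are pairs $(H,J)$ of $k$-linear functors $H:\mathcal C_1\to\mathcal C_2$, $J:\mathcal B\to\mathcal B$ with $J$ an isomorphism which is the identity on objects and $F_2H=JF_1$. It is known that such a morphism induces a unique group epimorphism $\lambda_H:\mathsf{Aut}_1F_1\to\mathsf{Aut}_1F_2$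 with $Hf=\lambda_H(f)H$ for all $f\in\mathsf{Aut}_1F_1$. *)

theory Defs
  imports "HOL-Algebra.Module" "HOL-Algebra.Group_Action"
begin

section \<open>Modules: direct sums and isomorphisms\<close>

text \<open>The ring fields \<open>mult\<close> and \<open>one\<close> of the record \<open>module\<close> carry no meaning for a module, here and
  in the morphism modules of a \<open>k\<close>-category below.\<close>

definition direct_sum :: "'i set \<Rightarrow> ('i \<Rightarrow> ('r, 'm) module) \<Rightarrow> ('r, 'i \<Rightarrow> 'm) module" where
  "direct_sum I M =
     \<lparr>carrier = {v \<in> (\<Pi>\<^sub>E i\<in>I. carrier (M i)). finite {i \<in> I. v i \<noteq> \<zero>\<^bsub>M i\<^esub>}},
      monoid.mult = undefined,
      monoid.one = undefined,
      ring.zero = (\<lambda>i\<in>I. \<zero>\<^bsub>M i\<^esub>),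
      ring.add = (\<lambda>v w. \<lambda>i\<in>I. v i \<oplus>\<^bsub>M i\<^esub> w i),
      module.smult = (\<lambda>a v. \<lambda>i\<in>I. a \<odot>\<^bsub>M i\<^esub> v i)\<rparr>"

text \<open>\<open>M\<close> is the internal direct sum of the submodules \<open>N i\<close>: the summation map from the external
  direct sum of the \<open>N i\<close> to \<open>M\<close> is bijective.\<close>

definition internal_direct_sum ::
    "('r, 'p) ring_scheme \<Rightarrow> ('r, 'm) module \<Rightarrow> 'i set \<Rightarrow> ('i \<Rightarrow> 'm set) \<Rightarrow> bool" where
  "internal_direct_sum k M I N \<longleftrightarrow>
     (\<forall>i\<in>I. submodule (N i) k M) \<and>
     bij_betw (\<lambda>v. finsum M v {i \<in> I. v i \<noteq> \<zero>\<^bsub>M\<^esub>})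
       (carrier (direct_sum I (\<lambda>i. M\<lparr>carrier := N i\<rparr>))) (carrier M)"

definition module_iso ::
    "('r, 'p) ring_scheme \<Rightarrow> ('r, 'm) module \<Rightarrow> ('r, 'n) module \<Rightarrow> ('m \<Rightarrow> 'n) set" where
  "module_iso k M N =
     {h \<in> iso (add_monoid M) (add_monoid N).
        \<forall>a\<in>carrier k. \<forall>v\<in>carrier M. h (a \<odot>\<^bsub>M\<^esub> v) = a \<odot>\<^bsub>N\<^esub> h v}"


section \<open>\<open>k\<close>-categories\<close>

text \<open>\<open>Mor C x y\<close> is the module of morphisms from \<open>x\<close> to \<open>y\<close>.  Morphism modules for different pairs of
  objects may share elements, so composition carries its objects:
  \<open>Cmp C x y z g f\<close> is the composite of \<open>f\<close> from \<open>x\<close> to \<open>y\<close> and \<open>g\<close> from \<open>y\<close> to \<open>z\<close>.\<close>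

record ('o, 'r, 'm) kcat =
  Ob :: "'o set"
  Mor :: "'o \<Rightarrow> 'o \<Rightarrow> ('r, 'm) module"
  Cmp :: "'o \<Rightarrow> 'o \<Rightarrow> 'o \<Rightarrow> 'm \<Rightarrow> 'm \<Rightarrow> 'm"
  Idm :: "'o \<Rightarrow> 'm"

locale k_category = cring k
  for k :: "('r, 'p) ring_scheme" and C :: "('o, 'r, 'm) kcat" +
  assumes Mor_module: "\<lbrakk>x \<in> Ob C; y \<in> Ob C\<rbrakk> \<Longrightarrow> module k (Mor C x y)"
    and Idm_closed: "x \<in> Ob C \<Longrightarrow> Idm C x \<in> carrier (Mor C x x)"
    and Cmp_closed:
      "\<lbrakk>x \<in> Ob C; y \<in> Ob C; z \<in> Ob C; f \<in> carrier (Mor C x y); g \<in> carrier (Mor C y z)\<rbrakk>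
        \<Longrightarrow> Cmp C x y z g f \<in> carrier (Mor C x z)"
    and Cmp_Idm_left:
      "\<lbrakk>x \<in> Ob C; y \<in> Ob C; f \<in> carrier (Mor C x y)\<rbrakk> \<Longrightarrow> Cmp C x y y (Idm C y) f = f"
    and Cmp_Idm_right:
      "\<lbrakk>x \<in> Ob C; y \<in> Ob C; f \<in> carrier (Mor C x y)\<rbrakk> \<Longrightarrow> Cmp C x x y f (Idm C x) = f"
    and Cmp_assoc:
      "\<lbrakk>w \<in> Ob C; x \<in> Ob C; y \<in> Ob C; z \<in> Ob C;
        f \<in> carrier (Mor C w x); g \<in> carrier (Mor C x y); h \<in> carrier (Mor C y z)\<rbrakk>
        \<Longrightarrow> Cmp C w y z h (Cmp C w x y g f) = Cmp C w x z (Cmp C x y z h g) f"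
    and Cmp_add_left:
      "\<lbrakk>x \<in> Ob C; y \<in> Ob C; z \<in> Ob C;
        f \<in> carrier (Mor C x y); g \<in> carrier (Mor C y z); g' \<in> carrier (Mor C y z)\<rbrakk>
        \<Longrightarrow> Cmp C x y z (g \<oplus>\<^bsub>Mor C y z\<^esub> g') f
          = Cmp C x y z g f \<oplus>\<^bsub>Mor C x z\<^esub> Cmp C x y z g' f"
    and Cmp_add_right:
      "\<lbrakk>x \<in> Ob C; y \<in> Ob C; z \<in> Ob C;
        f \<in> carrier (Mor C x y); f' \<in> carrier (Mor C x y); g \<in> carrier (Mor C y z)\<rbrakk>
        \<Longrightarrow> Cmp C x y z g (f \<oplus>\<^bsub>Mor C x y\<^esub> f')
          = Cmp C x y z g f \<oplus>\<^bsub>Mor C x z\<^esub> Cmp C x y z g f'"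
    and Cmp_smult_left:
      "\<lbrakk>x \<in> Ob C; y \<in> Ob C; z \<in> Ob C; a \<in> carrier k;
        f \<in> carrier (Mor C x y); g \<in> carrier (Mor C y z)\<rbrakk>
        \<Longrightarrow> Cmp C x y z (a \<odot>\<^bsub>Mor C y z\<^esub> g) f = a \<odot>\<^bsub>Mor C x z\<^esub> Cmp C x y z g f"
    and Cmp_smult_right:
      "\<lbrakk>x \<in> Ob C; y \<in> Ob C; z \<in> Ob C; a \<in> carrier k;
        f \<in> carrier (Mor C x y); g \<in> carrier (Mor C y z)\<rbrakk>
        \<Longrightarrow> Cmp C x y z g (a \<odot>\<^bsub>Mor C x y\<^esub> f) = a \<odot>\<^bsub>Mor C x z\<^esub> Cmp C x y z g f"

text \<open>\<open>walk_joined C x y\<close>: there is a non-zero walk from \<open>x\<close> to \<open>y\<close>.  The empty walk is allowed; this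
  only matters for a category with a single object whose endomorphism module is zero.\<close>

inductive walk_joined :: "('o, 'r, 'm) kcat \<Rightarrow> 'o \<Rightarrow> 'o \<Rightarrow> bool" for C where
  nil: "x \<in> Ob C \<Longrightarrow> walk_joined C x x"
| fwd: "\<lbrakk>walk_joined C x y; z \<in> Ob C; f \<in> carrier (Mor C y z); f \<noteq> \<zero>\<^bsub>Mor C y z\<^esub>\<rbrakk>
          \<Longrightarrow> walk_joined C x z"
| bwd: "\<lbrakk>walk_joined C x y; z \<in> Ob C; f \<in> carrier (Mor C z y); f \<noteq> \<zero>\<^bsub>Mor C z y\<^esub>\<rbrakk>
          \<Longrightarrow> walk_joined C x z"

definition connected_kcat :: "('o, 'r, 'm) kcat \<Rightarrow> bool" where
  "connected_kcat C \<longleftrightarrow> (\<forall>x\<in>Ob C. \<forall>y\<in>Ob C. walk_joined C x y)"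


section \<open>\<open>k\<close>-linear functors\<close>

record ('o, 'm, 'q, 'n) kfun =
  fobj :: "'o \<Rightarrow> 'q"
  fmor :: "'o \<Rightarrow> 'o \<Rightarrow> 'm \<Rightarrow> 'n"

text \<open>Functors are kept extensional, i.e. \<open>undefined\<close> off the objects and morphisms of their domain, so
  that equality of functors is HOL equality.\<close>

definition mk_fun ::
    "('o, 'r, 'm) kcat \<Rightarrow> ('o \<Rightarrow> 'q) \<Rightarrow> ('o \<Rightarrow> 'o \<Rightarrow> 'm \<Rightarrow> 'n) \<Rightarrow> ('o, 'm, 'q, 'n) kfun" where
  "mk_fun C p q =
     \<lparr>fobj = restrict p (Ob C),
      fmor = (\<lambda>x y. restrict (q x y) {f. x \<in> Ob C \<and> y \<in> Ob C \<and> f \<in> carrier (Mor C x y)})\<rparr>"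

definition k_functor ::
    "('r, 'p) ring_scheme \<Rightarrow> ('o, 'r, 'm) kcat \<Rightarrow> ('q, 'r, 'n) kcat
      \<Rightarrow> ('o, 'm, 'q, 'n) kfun \<Rightarrow> bool" where
  "k_functor k C D F \<longleftrightarrow>
     k_category k C \<and> k_category k D \<and>
     F = mk_fun C (fobj F) (fmor F) \<and>
     (\<forall>x\<in>Ob C. fobj F x \<in> Ob D) \<and>
     (\<forall>x\<in>Ob C. \<forall>y\<in>Ob C. \<forall>f\<in>carrier (Mor C x y).
        fmor F x y f \<in> carrier (Mor D (fobj F x) (fobj F y))) \<and>
     (\<forall>x\<in>Ob C. fmor F x x (Idm C x) = Idm D (fobj F x)) \<and>
     (\<forall>x\<in>Ob C. \<forall>y\<in>Ob C. \<forall>z\<in>Ob C. \<forall>f\<in>carrier (Mor C x y). \<forall>g\<in>carrier (Mor C y z).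
        fmor F x z (Cmp C x y z g f)
          = Cmp D (fobj F x) (fobj F y) (fobj F z) (fmor F y z g) (fmor F x y f)) \<and>
     (\<forall>x\<in>Ob C. \<forall>y\<in>Ob C. \<forall>f\<in>carrier (Mor C x y). \<forall>g\<in>carrier (Mor C x y).
        fmor F x y (f \<oplus>\<^bsub>Mor C x y\<^esub> g)
          = fmor F x y f \<oplus>\<^bsub>Mor D (fobj F x) (fobj F y)\<^esub> fmor F x y g) \<and>
     (\<forall>x\<in>Ob C. \<forall>y\<in>Ob C. \<forall>a\<in>carrier k. \<forall>f\<in>carrier (Mor C x y).
        fmor F x y (a \<odot>\<^bsub>Mor C x y\<^esub> f)
          = a \<odot>\<^bsub>Mor D (fobj F x) (fobj F y)\<^esub> fmor F x y f)"

definition id_fun :: "('o, 'r, 'm) kcat \<Rightarrow> ('o, 'm, 'o, 'm) kfun" where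
  "id_fun C = mk_fun C (\<lambda>x. x) (\<lambda>x y f. f)"

text \<open>\<open>comp_fun C F' F\<close> is \<open>F'\<close> after \<open>F\<close>, where \<open>C\<close> is the domain of \<open>F\<close>.\<close>

definition comp_fun ::
    "('o, 'r, 'm) kcat \<Rightarrow> ('q, 'n, 's, 'l) kfun \<Rightarrow> ('o, 'm, 'q, 'n) kfun
      \<Rightarrow> ('o, 'm, 's, 'l) kfun" where
  "comp_fun C F' F =
     mk_fun C (\<lambda>x. fobj F' (fobj F x)) (\<lambda>x y f. fmor F' (fobj F x) (fobj F y) (fmor F x y f))"

definition k_functor_iso ::
    "('r, 'p) ring_scheme \<Rightarrow> ('o, 'r, 'm) kcat \<Rightarrow> ('q, 'r, 'n) kcat
      \<Rightarrow> ('o, 'm, 'q, 'n) kfun \<Rightarrow> bool" where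
  "k_functor_iso k C D F \<longleftrightarrow>
     k_functor k C D F \<and>
     (\<exists>F'. k_functor k D C F' \<and> comp_fun C F' F = id_fun C \<and> comp_fun D F F' = id_fun D)"


section \<open>Galois coverings\<close>

text \<open>In the star at \<open>x\<close>, the index \<open>Inl y\<close> stands for the morphisms from \<open>x\<close> to \<open>y\<close> and \<open>Inr y\<close> for those
  from \<open>y\<close> to \<open>x\<close>, so the endomorphisms of \<open>x\<close> occur twice.\<close>

definition star :: "('o, 'r, 'm) kcat \<Rightarrow> 'o \<Rightarrow> ('r, 'o + 'o \<Rightarrow> 'm) module" where
  "star C x =
     direct_sum (Ob C <+> Ob C) (\<lambda>i. case i of Inl y \<Rightarrow> Mor C x y | Inr y \<Rightarrow> Mor C y x)"

definition star_map ::
    "('o, 'r, 'm) kcat \<Rightarrow> ('q, 'r, 'n) kcat \<Rightarrow> ('o, 'm, 'q, 'n) kfun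
      \<Rightarrow> 'o \<Rightarrow> ('o + 'o \<Rightarrow> 'm) \<Rightarrow> ('q + 'q \<Rightarrow> 'n)" where
  "star_map C B F x v =
     (\<lambda>i \<in> Ob B <+> Ob B. case i of
        Inl c \<Rightarrow> finsum (Mor B (fobj F x) c) (\<lambda>y. fmor F x y (v (Inl y)))
                   {y \<in> Ob C. fobj F y = c \<and> v (Inl y) \<noteq> \<zero>\<^bsub>Mor C x y\<^esub>}
      | Inr c \<Rightarrow> finsum (Mor B c (fobj F x)) (\<lambda>y. fmor F y x (v (Inr y)))
                   {y \<in> Ob C. fobj F y = c \<and> v (Inr y) \<noteq> \<zero>\<^bsub>Mor C y x\<^esub>})"

definition covering ::
    "('r, 'p) ring_scheme \<Rightarrow> ('o, 'r, 'm) kcat \<Rightarrow> ('q, 'r, 'n) kcat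
      \<Rightarrow> ('o, 'm, 'q, 'n) kfun \<Rightarrow> bool" where
  "covering k C B F \<longleftrightarrow>
     k_functor k C B F \<and>
     fobj F ` Ob C = Ob B \<and>
     (\<forall>x\<in>Ob C. star_map C B F x \<in> module_iso k (star C x) (star B (fobj F x)))"

definition Aut1 ::
    "('r, 'p) ring_scheme \<Rightarrow> ('o, 'r, 'm) kcat \<Rightarrow> ('o, 'm, 'q, 'n) kfun
      \<Rightarrow> ('o, 'm, 'o, 'm) kfun monoid" where
  "Aut1 k C F =
     \<lparr>carrier = {f. k_functor_iso k C C f \<and> comp_fun C F f = F},
      monoid.mult = comp_fun C,
      monoid.one = id_fun C\<rparr>"

definition galois_covering ::
    "('r, 'p) ring_scheme \<Rightarrow> ('o, 'r, 'm) kcat \<Rightarrow> ('q, 'r, 'n) kcat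
      \<Rightarrow> ('o, 'm, 'q, 'n) kfun \<Rightarrow> bool" where
  "galois_covering k C B F \<longleftrightarrow>
     covering k C B F \<and>
     connected_kcat C \<and>
     (\<exists>b\<in>Ob B. \<forall>x\<in>Ob C. \<forall>y\<in>Ob C. fobj F x = b \<and> fobj F y = b \<longrightarrow>
        (\<exists>f\<in>carrier (Aut1 k C F). fobj f x = y))"

text \<open>\<open>(H, J)\<close> is a morphism of \<open>Gal(B, b\<^sub>0)\<close> from \<open>F\<^sub>1 : C\<^sub>1 \<rightarrow> B\<close> to \<open>F\<^sub>2 : C\<^sub>2 \<rightarrow> B\<close>; neither the objects
  nor the morphisms of that category depend on \<open>b\<^sub>0\<close>.\<close>

definition gal_morphism ::
    "('r, 'p) ring_scheme \<Rightarrow> ('q, 'r, 'n) kcat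
      \<Rightarrow> ('o1, 'r, 'm1) kcat \<Rightarrow> ('o1, 'm1, 'q, 'n) kfun
      \<Rightarrow> ('o2, 'r, 'm2) kcat \<Rightarrow> ('o2, 'm2, 'q, 'n) kfun
      \<Rightarrow> ('o1, 'm1, 'o2, 'm2) kfun \<Rightarrow> ('q, 'n, 'q, 'n) kfun \<Rightarrow> bool" where
  "gal_morphism k B C1 F1 C2 F2 H J \<longleftrightarrow>
     galois_covering k C1 B F1 \<and> galois_covering k C2 B F2 \<and>
     k_functor k C1 C2 H \<and>
     k_functor_iso k B B J \<and> (\<forall>b\<in>Ob B. fobj J b = b) \<and>
     comp_fun C1 F2 H = comp_fun C1 J F1"

text \<open>The epimorphism \<open>\<lambda>\<^sub>H\<close> from \<open>Aut\<^sub>1 F\<^sub>1\<close> to \<open>Aut\<^sub>1 F\<^sub>2\<close> with \<open>H f = \<lambda>\<^sub>H(f) H\<close>.\<close>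

definition lambda_aut ::
    "('r, 'p) ring_scheme
      \<Rightarrow> ('o1, 'r, 'm1) kcat \<Rightarrow> ('o1, 'm1, 'q, 'n) kfun
      \<Rightarrow> ('o2, 'r, 'm2) kcat \<Rightarrow> ('o2, 'm2, 'q, 'n) kfun
      \<Rightarrow> ('o1, 'm1, 'o2, 'm2) kfun
      \<Rightarrow> ('o1, 'm1, 'o1, 'm1) kfun \<Rightarrow> ('o2, 'm2, 'o2, 'm2) kfun" where
  "lambda_aut k C1 F1 C2 F2 H =
     (THE l. l \<in> epi (Aut1 k C1 F1) (Aut1 k C2 F2) \<and>
             l \<in> extensional (carrier (Aut1 k C1 F1)) \<and>
             (\<forall>f\<in>carrier (Aut1 k C1 F1). comp_fun C1 H f = comp_fun C1 (l f) H))"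


section \<open>Gradings and smash products\<close>

text \<open>\<open>X b c s\<close> is the homogeneous component of degree \<open>s\<close> of the morphisms from \<open>b\<close> to \<open>c\<close>.\<close>

definition grading ::
    "('r, 'p) ring_scheme \<Rightarrow> ('o, 'r, 'm) kcat \<Rightarrow> ('g, 'z) monoid_scheme
      \<Rightarrow> ('o \<Rightarrow> 'o \<Rightarrow> 'g \<Rightarrow> 'm set) \<Rightarrow> bool" where
  "grading k B G X \<longleftrightarrow>
     k_category k B \<and> group G \<and>
     (\<forall>x\<in>Ob B. \<forall>y\<in>Ob B. internal_direct_sum k (Mor B x y) (carrier G) (X x y)) \<and>
     (\<forall>x\<in>Ob B. \<forall>y\<in>Ob B. \<forall>z\<in>Ob B. \<forall>s\<in>carrier G. \<forall>t\<in>carrier G. \<forall>f\<in>X x y s. \<forall>g\<in>X y z t.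
        Cmp B x y z g f \<in> X x z (t \<otimes>\<^bsub>G\<^esub> s))"

text \<open>\<open>hom_walk B G X x y d\<close>: there is a non-zero homogeneous walk from \<open>x\<close> to \<open>y\<close> of degree \<open>d\<close>.\<close>

inductive hom_walk ::
    "('o, 'r, 'm) kcat \<Rightarrow> ('g, 'z) monoid_scheme \<Rightarrow> ('o \<Rightarrow> 'o \<Rightarrow> 'g \<Rightarrow> 'm set)
      \<Rightarrow> 'o \<Rightarrow> 'o \<Rightarrow> 'g \<Rightarrow> bool" for B G X where
  nil: "x \<in> Ob B \<Longrightarrow> hom_walk B G X x x \<one>\<^bsub>G\<^esub>"
| fwd: "\<lbrakk>hom_walk B G X x y d; z \<in> Ob B; s \<in> carrier G; f \<in> X y z s; f \<noteq> \<zero>\<^bsub>Mor B y z\<^esub>\<rbrakk>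
          \<Longrightarrow> hom_walk B G X x z (s \<otimes>\<^bsub>G\<^esub> d)"
| bwd: "\<lbrakk>hom_walk B G X x y d; z \<in> Ob B; s \<in> carrier G; f \<in> X z y s; f \<noteq> \<zero>\<^bsub>Mor B z y\<^esub>\<rbrakk>
          \<Longrightarrow> hom_walk B G X x z (inv\<^bsub>G\<^esub> s \<otimes>\<^bsub>G\<^esub> d)"

definition connected_grading ::
    "('r, 'p) ring_scheme \<Rightarrow> ('o, 'r, 'm) kcat \<Rightarrow> ('g, 'z) monoid_scheme
      \<Rightarrow> ('o \<Rightarrow> 'o \<Rightarrow> 'g \<Rightarrow> 'm set) \<Rightarrow> bool" where
  "connected_grading k B G X \<longleftrightarrow>
     grading k B G X \<and> (\<forall>x\<in>Ob B. \<forall>y\<in>Ob B. \<forall>d\<in>carrier G. hom_walk B G X x y d)"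

definition smash ::
    "('o, 'r, 'm) kcat \<Rightarrow> ('g, 'z) monoid_scheme \<Rightarrow> ('o \<Rightarrow> 'o \<Rightarrow> 'g \<Rightarrow> 'm set)
      \<Rightarrow> ('o \<times> 'g, 'r, 'm) kcat" where
  "smash B G X =
     \<lparr>Ob = Ob B \<times> carrier G,
      Mor = (\<lambda>(b, g) (c, h). (Mor B b c)\<lparr>carrier := X b c (inv\<^bsub>G\<^esub> h \<otimes>\<^bsub>G\<^esub> g)\<rparr>),
      Cmp = (\<lambda>(b, g) (c, h) (d, i). Cmp B b c d),
      Idm = (\<lambda>(b, g). Idm B b)\<rparr>"

definition smash_proj ::
    "('o, 'r, 'm) kcat \<Rightarrow> ('g, 'z) monoid_scheme \<Rightarrow> ('o \<Rightarrow> 'o \<Rightarrow> 'g \<Rightarrow> 'm set)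
      \<Rightarrow> ('o \<times> 'g, 'm, 'o, 'm) kfun" where
  "smash_proj B G X = mk_fun (smash B G X) fst (\<lambda>x y f. f)"

definition smash_act ::
    "('o, 'r, 'm) kcat \<Rightarrow> ('g, 'z) monoid_scheme \<Rightarrow> ('o \<Rightarrow> 'o \<Rightarrow> 'g \<Rightarrow> 'm set)
      \<Rightarrow> 'g \<Rightarrow> ('o \<times> 'g, 'm, 'o \<times> 'g, 'm) kfun" where
  "smash_act B G X u = mk_fun (smash B G X) (\<lambda>(b, g). (b, u \<otimes>\<^bsub>G\<^esub> g)) (\<lambda>x y f. f)"

text \<open>\<open>\<lambda>\<^sub>H\<close> as a map from \<open>G\<^sub>1\<close> to \<open>G\<^sub>2\<close>, under the identifications \<open>smash_act\<close> of \<open>G\<^sub>i\<close> with \<open>Aut\<^sub>1 F\<^sub>i\<close>.\<close>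

definition lambda_smash ::
    "('r, 'p) ring_scheme \<Rightarrow> ('o, 'r, 'm) kcat
      \<Rightarrow> ('g1, 'z1) monoid_scheme \<Rightarrow> ('o \<Rightarrow> 'o \<Rightarrow> 'g1 \<Rightarrow> 'm set)
      \<Rightarrow> ('g2, 'z2) monoid_scheme \<Rightarrow> ('o \<Rightarrow> 'o \<Rightarrow> 'g2 \<Rightarrow> 'm set)
      \<Rightarrow> ('o \<times> 'g1, 'm, 'o \<times> 'g2, 'm) kfun \<Rightarrow> 'g1 \<Rightarrow> 'g2" where
  "lambda_smash k B G1 X1 G2 X2 H u =
     inv_into (carrier G2) (smash_act B G2 X2)
       (lambda_aut k (smash B G1 X1) (smash_proj B G1 X1) (smash B G2 X2) (smash_proj B G2 X2) H
         (smash_act B G1 X1 u))"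


section \<open>\<open>G\<close>-sets\<close>

definition left_mult :: "('g, 'z) monoid_scheme \<Rightarrow> 'g \<Rightarrow> 'g \<Rightarrow> 'g" where
  "left_mult G u = (\<lambda>g\<in>carrier G. u \<otimes>\<^bsub>G\<^esub> g)"

definition gset_morphism ::
    "('g, 'z) monoid_scheme \<Rightarrow> 'a set \<Rightarrow> ('g \<Rightarrow> 'a \<Rightarrow> 'a) \<Rightarrow> 'b set \<Rightarrow> ('g \<Rightarrow> 'b \<Rightarrow> 'b)
      \<Rightarrow> ('a \<Rightarrow> 'b) \<Rightarrow> bool" where
  "gset_morphism G E \<phi> E' \<psi> h \<longleftrightarrow>
     group_action G E \<phi> \<and> group_action G E' \<psi> \<and> h \<in> E \<rightarrow> E' \<and>
     (\<forall>u\<in>carrier G. \<forall>x\<in>E. h (\<phi> u x) = \<psi> u (h x))"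

end

theory Submission
  imports Defs
begin

text \<open>The functor \<open>H\<close> lies over the identity on objects, so it maps the fibre \<open>{b\<^sub>0} \<times> G\<^sub>1\<close> to
  \<open>{b\<^sub>0} \<times> G\<^sub>2\<close>; this is the map \<open>h\<close>.  Everything else follows once \<open>\<lambda>\<^sub>H(u)\<close> is identified with
  \<open>h(u) h(1)\<^sup>-\<^sup>1\<close>: comparing the two sides of \<open>H u = \<lambda>\<^sub>H(u) H\<close> at the object \<open>(b\<^sub>0, g)\<close> gives
  \<open>h(u g) = \<lambda>\<^sub>H(u) h(g)\<close>, which is equivariance, and \<open>g = 1\<close> gives the formula for \<open>h\<close>.

  As \<open>\<lambda>\<^sub>H\<close> is defined by a unique description, its existence, surjectivity and uniqueness must be
  proved on the way.  Two facts about smash products carry this.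

  \<^item> Unique lifting (\<open>smash_lifts_equal\<close>): two functors from a connected category to \<open>B#G\<close> that agree
    after projection to \<open>B\<close>, kill no non-zero morphism and agree at one object are equal.  Indeed
    the degree of a non-zero homogeneous morphism is unique, so along a non-zero walk the group
    coordinate at one end determines that at the other end.  This shows that every element of
    \<open>Aut\<^sub>1\<close> is the action of a group element, that \<open>H u = \<lambda>(u) H\<close> for
    \<open>\<lambda>(u) = h(u) h(1)\<^sup>-\<^sup>1\<close>, since both sides agree at \<open>(b\<^sub>0, 1)\<close>, and that no other
    automorphism has this property.
  \<^item> Surjectivity of \<open>H\<close> on objects (\<open>fobj_H_surj\<close>): walks in \<open>B#G\<^sub>2\<close> can be traced back through
    \<open>H\<close>.  The preimage under \<open>J\<close> of an \<open>X\<^sub>2\<close>-homogeneous morphism need not be \<open>X\<^sub>1\<close>-homogeneous, but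
    \<open>J\<close> sends each of its \<open>X\<^sub>1\<close>-components to an \<open>X\<^sub>2\<close>-homogeneous morphism, and one of these must
    have the degree of the given one.  Hence \<open>h\<close>, and with it \<open>\<lambda>\<close>, is surjective.\<close>

section \<open>Homogeneous components in a direct sum\<close>

lemma (in abelian_monoid) finsum_over_support:
  "finsum G f {i \<in> A. f i \<noteq> \<zero>} = finsum G f A" if "finite A" "f \<in> A \<rightarrow> carrier G"
  by (rule add.finprod_mono_neutral_cong_left) (use that in auto)

lemma internal_direct_sum_subset:
  assumes "internal_direct_sum k M I N" and "i \<in> I"
  shows "N i \<subseteq> carrier M" and "\<zero>\<^bsub>M\<^esub> \<in> N i"
    and "\<And>x y. x \<in> N i \<Longrightarrow> y \<in> N i \<Longrightarrow> x \<oplus>\<^bsub>M\<^esub> y \<in> N i"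
proof -
  have s: "subgroup (N i) (add_monoid M)"
    using assms by (auto simp: internal_direct_sum_def submodule_def)
  show "N i \<subseteq> carrier M" using subgroup.subset[OF s] by simp
  show "\<zero>\<^bsub>M\<^esub> \<in> N i" using subgroup.one_closed[OF s] by simp
  show "\<And>x y. x \<in> N i \<Longrightarrow> y \<in> N i \<Longrightarrow> x \<oplus>\<^bsub>M\<^esub> y \<in> N i"
    using subgroup.m_closed[OF s] by simp
qed

lemma internal_direct_sum_finsum_mem:
  assumes M: "abelian_group M" and ds: "internal_direct_sum k M I N" and i: "i \<in> I"
    and "finite A" and "\<And>a. a \<in> A \<Longrightarrow> n a \<in> N i"
  shows "finsum M n A \<in> N i"
proof -
  interpret abelian_group M by fact
  note N = internal_direct_sum_subset[OF ds i]
  show ?thesis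
    using assms(4,5)
  proof (induction A)
    case empty
    then show ?case using N by simp
  next
    case (insert a A)
    then have "n a \<in> N i" "finsum M n A \<in> N i" "n \<in> insert a A \<rightarrow> carrier M"
      using N(1) by auto
    then show ?case using insert N(3) by (auto simp: finsum_insert)
  qed
qed

lemma internal_direct_sum_decomposition:
  assumes ds: "internal_direct_sum k M I N" and m: "m \<in> carrier M"
  obtains A n where "finite A" "A \<subseteq> I" "\<And>a. a \<in> A \<Longrightarrow> n a \<in> N a" "m = finsum M n A"
proof -
  let ?C = "carrier (direct_sum I (\<lambda>i. M\<lparr>carrier := N i\<rparr>))"
  have "bij_betw (\<lambda>v. finsum M v {i \<in> I. v i \<noteq> \<zero>\<^bsub>M\<^esub>}) ?C (carrier M)"
    using ds by (simp add: internal_direct_sum_def)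
  then have "m \<in> (\<lambda>v. finsum M v {i \<in> I. v i \<noteq> \<zero>\<^bsub>M\<^esub>}) ` ?C"
    using m by (simp add: bij_betw_def)
  then obtain v where v: "v \<in> ?C" "m = finsum M v {i \<in> I. v i \<noteq> \<zero>\<^bsub>M\<^esub>}" by blast
  show thesis
    by (rule that[of "{i \<in> I. v i \<noteq> \<zero>\<^bsub>M\<^esub>}" v]) (use v in \<open>auto simp: direct_sum_def\<close>)
qed

text \<open>The degrees \<open>d a\<close> need not be distinct.  Collecting the summands of equal degree gives a family
  with sum \<open>m\<close>; so does the family with the single entry \<open>m\<close> in degree \<open>s\<close>.  Directness makes the
  two equal, and the first one vanishes in every degree outside \<open>d ` A\<close>.\<close>

lemma internal_direct_sum_degree_occurs:
  assumes M: "abelian_group M" and ds: "internal_direct_sum k M I N"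
    and A: "finite A" and d: "\<And>a. a \<in> A \<Longrightarrow> d a \<in> I" and n: "\<And>a. a \<in> A \<Longrightarrow> n a \<in> N (d a)"
    and s: "s \<in> I" and m: "m \<in> N s" "m \<noteq> \<zero>\<^bsub>M\<^esub>" "m = finsum M n A"
  shows "s \<in> d ` A"
proof -
  interpret abelian_group M by fact
  let ?S = "\<lambda>v. finsum M v {i \<in> I. v i \<noteq> \<zero>\<^bsub>M\<^esub>}"
  let ?C = "carrier (direct_sum I (\<lambda>i. M\<lparr>carrier := N i\<rparr>))"
  have inj: "inj_on ?S ?C"
    using ds by (simp add: internal_direct_sum_def bij_betw_def)
  note N = internal_direct_sum_subset[OF ds]
  have nM: "n a \<in> carrier M" if "a \<in> A" for a using n d N(1) that by blast
  \<comment> \<open>The entries of \<open>w\<close> are the partial sums of equal degree, \<open>v\<close> is \<open>m\<close> placed in degree \<open>s\<close>.\<close>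
  define w where "w = (\<lambda>i\<in>I. finsum M n {a \<in> A. d a = i})"
  define v where "v = (\<lambda>i\<in>I. if i = s then m else \<zero>\<^bsub>M\<^esub>)"
  have wN: "w i \<in> N i" if "i \<in> I" for i
    using internal_direct_sum_finsum_mem[OF M ds that, of "{a \<in> A. d a = i}" n] A n that
    by (auto simp: w_def)
  have dA: "finite (d ` A)" "d ` A \<subseteq> I" using A d by auto
  have w0: "w i = \<zero>\<^bsub>M\<^esub>" if "i \<in> I" "i \<notin> d ` A" for i
  proof -
    have "{a \<in> A. d a = i} = {}" using that by auto
    then have "w i = finsum M n {}" using that(1) by (simp only: w_def restrict_apply' refl)
    then show ?thesis by simp
  qed
  have CI: "u \<in> ?C" if "u \<in> extensional I" "\<And>i. i \<in> I \<Longrightarrow> u i \<in> N i" "finite {i \<in> I. u i \<noteq> \<zero>\<^bsub>M\<^esub>}"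
    for u
    using that by (simp add: direct_sum_def PiE_iff)
  have wsupp: "{i \<in> I. w i \<noteq> \<zero>\<^bsub>M\<^esub>} = {i \<in> d ` A. w i \<noteq> \<zero>\<^bsub>M\<^esub>}"
    using w0 dA by blast
  have wC: "w \<in> ?C"
    by (rule CI) (use wN dA(1) in \<open>simp_all add: wsupp\<close>, simp add: w_def)
  have vN: "v i \<in> N i" if "i \<in> I" for i 
    using N(2)[OF that] m(1) that by (simp add: v_def)
  have vsupp: "{i \<in> I. v i \<noteq> \<zero>\<^bsub>M\<^esub>} = {s}" using s m(2) by (auto simp: v_def)
  have vC: "v \<in> ?C"
    by (rule CI) (use vN in \<open>simp_all add: vsupp\<close>, simp add: v_def)
  have "v s = m" using s by (simp add: v_def)
  moreover have "m \<in> carrier M" using N(1)[OF s] m(1) by blast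
  ultimately have "?S v = m"
    unfolding vsupp by (subst finsum_insert) simp_all
  moreover have "?S w = m"
  proof -
    have "?S w = finsum M w (d ` A)"
      unfolding wsupp
      by (rule finsum_over_support) (use dA wN N(1) in blast)+
    also have "\<dots> = finsum M (\<lambda>i. finsum M n {a \<in> A. d a = i}) (d ` A)"
    proof (rule add.finprod_cong')
      show "(\<lambda>i. finsum M n {a \<in> A. d a = i}) \<in> d ` A \<rightarrow> carrier M"
        using nM by (auto intro: finsum_closed)
      show "w i = finsum M n {a \<in> A. d a = i}" if "i \<in> d ` A" for i
        using that dA(2) by (auto simp only: w_def restrict_apply')
    qed simp
    also have "\<dots> = finsum M n (\<Union>i\<in>d ` A. {a \<in> A. d a = i})"
      by (rule add.finprod_UN_disjoint[symmetric])
        (use A nM in \<open>auto simp: pairwise_def disjnt_def\<close>)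
    also have "(\<Union>i\<in>d ` A. {a \<in> A. d a = i}) = A" by auto
    finally show ?thesis using m(3) by simp
  qed
  ultimately have "w = v" using inj wC vC by (metis (no_types, lifting) inj_onD)
  then have "w s \<noteq> \<zero>\<^bsub>M\<^esub>" using s m(2) by (simp add: v_def)
  then show ?thesis using w0 s by blast
qed

lemma internal_direct_sum_degree_unique:
  assumes "abelian_group M" and "internal_direct_sum k M I N"
    and "i \<in> I" and "j \<in> I" and "m \<in> N i" and "m \<in> N j" and "m \<noteq> \<zero>\<^bsub>M\<^esub>"
  shows "i = j"
proof -
  interpret abelian_group M by fact
  have "m \<in> carrier M" using internal_direct_sum_subset(1)[OF assms(2,3)] assms(5) by blast
  then have "m = finsum M (\<lambda>_. m) {()}" by (subst finsum_insert) auto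
  with internal_direct_sum_degree_occurs[OF assms(1,2), of "{()}" "\<lambda>_. j" "\<lambda>_. m" i m] assms
  show ?thesis by auto
qed


section \<open>Functors between k-categories\<close>

lemma fobj_mk_fun [simp]: "x \<in> Ob C \<Longrightarrow> fobj (mk_fun C p q) x = p x"
  by (simp add: mk_fun_def)

lemma fmor_mk_fun [simp]:
  "\<lbrakk>x \<in> Ob C; y \<in> Ob C; m \<in> carrier (Mor C x y)\<rbrakk> \<Longrightarrow> fmor (mk_fun C p q) x y m = q x y m"
  by (simp add: mk_fun_def)

lemma fobj_comp_fun [simp]:
  "x \<in> Ob C \<Longrightarrow> fobj (comp_fun C F' F) x = fobj F' (fobj F x)"
  by (simp add: comp_fun_def)

lemma fmor_comp_fun [simp]:
  "\<lbrakk>x \<in> Ob C; y \<in> Ob C; m \<in> carrier (Mor C x y)\<rbrakk>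
    \<Longrightarrow> fmor (comp_fun C F' F) x y m = fmor F' (fobj F x) (fobj F y) (fmor F x y m)"
  by (simp add: comp_fun_def)

lemma fobj_id_fun [simp]: "x \<in> Ob C \<Longrightarrow> fobj (id_fun C) x = x"
  by (simp add: id_fun_def)

lemma fmor_id_fun [simp]:
  "\<lbrakk>x \<in> Ob C; y \<in> Ob C; m \<in> carrier (Mor C x y)\<rbrakk> \<Longrightarrow> fmor (id_fun C) x y m = m"
  by (simp add: id_fun_def)

lemma mk_fun_cong:
  assumes "\<And>x. x \<in> Ob C \<Longrightarrow> p x = p' x"
    and "\<And>x y m. \<lbrakk>x \<in> Ob C; y \<in> Ob C; m \<in> carrier (Mor C x y)\<rbrakk> \<Longrightarrow> q x y m = q' x y m"
  shows "mk_fun C p q = mk_fun C p' q'"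
  using assms by (auto simp: mk_fun_def fun_eq_iff restrict_def)

lemma k_functorD:
  assumes "k_functor k C D F"
  shows "k_category k C" and "k_category k D" and "F = mk_fun C (fobj F) (fmor F)"
    and "x \<in> Ob C \<Longrightarrow> fobj F x \<in> Ob D"
    and "\<lbrakk>x \<in> Ob C; y \<in> Ob C; m \<in> carrier (Mor C x y)\<rbrakk>
      \<Longrightarrow> fmor F x y m \<in> carrier (Mor D (fobj F x) (fobj F y))"
    and "x \<in> Ob C \<Longrightarrow> fmor F x x (Idm C x) = Idm D (fobj F x)"
    and "\<lbrakk>x \<in> Ob C; y \<in> Ob C; z \<in> Ob C; m \<in> carrier (Mor C x y); n \<in> carrier (Mor C y z)\<rbrakk>
      \<Longrightarrow> fmor F x z (Cmp C x y z n m)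
          = Cmp D (fobj F x) (fobj F y) (fobj F z) (fmor F y z n) (fmor F x y m)"
    and "\<lbrakk>x \<in> Ob C; y \<in> Ob C; m \<in> carrier (Mor C x y); m' \<in> carrier (Mor C x y)\<rbrakk>
      \<Longrightarrow> fmor F x y (m \<oplus>\<^bsub>Mor C x y\<^esub> m')
          = fmor F x y m \<oplus>\<^bsub>Mor D (fobj F x) (fobj F y)\<^esub> fmor F x y m'"
    and "\<lbrakk>x \<in> Ob C; y \<in> Ob C; a \<in> carrier k; m \<in> carrier (Mor C x y)\<rbrakk>
      \<Longrightarrow> fmor F x y (a \<odot>\<^bsub>Mor C x y\<^esub> m)
          = a \<odot>\<^bsub>Mor D (fobj F x) (fobj F y)\<^esub> fmor F x y m"
  using assms unfolding k_functor_def by blast+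

lemma k_functor_eqI:
  assumes F: "k_functor k C D F" and F': "k_functor k C D' F'"
    and "\<And>x. x \<in> Ob C \<Longrightarrow> fobj F x = fobj F' x"
    and "\<And>x y m. \<lbrakk>x \<in> Ob C; y \<in> Ob C; m \<in> carrier (Mor C x y)\<rbrakk>
      \<Longrightarrow> fmor F x y m = fmor F' x y m"
  shows "F = F'"
proof -
  have "mk_fun C (fobj F) (fmor F) = mk_fun C (fobj F') (fmor F')"
    by (rule mk_fun_cong) (use assms(3,4) in auto)
  then show ?thesis using k_functorD(3)[OF F] k_functorD(3)[OF F'] by simp
qed

lemma comp_fun_eqI:
  assumes "\<And>x. x \<in> Ob C \<Longrightarrow> fobj P' (fobj P x) = fobj Q' (fobj Q x)"
    and "\<And>x y m. \<lbrakk>x \<in> Ob C; y \<in> Ob C; m \<in> carrier (Mor C x y)\<rbrakk>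
      \<Longrightarrow> fmor P' (fobj P x) (fobj P y) (fmor P x y m) = fmor Q' (fobj Q x) (fobj Q y) (fmor Q x y m)"
  shows "comp_fun C P' P = comp_fun C Q' Q"
  unfolding comp_fun_def by (rule mk_fun_cong) (use assms in auto)

lemma k_functor_mk_funI:
  assumes C: "k_category k C" and D: "k_category k D"
    and "\<And>x. x \<in> Ob C \<Longrightarrow> p x \<in> Ob D"
    and "\<And>x y m. \<lbrakk>x \<in> Ob C; y \<in> Ob C; m \<in> carrier (Mor C x y)\<rbrakk>
      \<Longrightarrow> q x y m \<in> carrier (Mor D (p x) (p y))"
    and "\<And>x. x \<in> Ob C \<Longrightarrow> q x x (Idm C x) = Idm D (p x)"
    and "\<And>x y z m n. \<lbrakk>x \<in> Ob C; y \<in> Ob C; z \<in> Ob C; m \<in> carrier (Mor C x y);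
        n \<in> carrier (Mor C y z)\<rbrakk>
      \<Longrightarrow> q x z (Cmp C x y z n m) = Cmp D (p x) (p y) (p z) (q y z n) (q x y m)"
    and "\<And>x y m m'. \<lbrakk>x \<in> Ob C; y \<in> Ob C; m \<in> carrier (Mor C x y); m' \<in> carrier (Mor C x y)\<rbrakk>
      \<Longrightarrow> q x y (m \<oplus>\<^bsub>Mor C x y\<^esub> m') = q x y m \<oplus>\<^bsub>Mor D (p x) (p y)\<^esub> q x y m'"
    and "\<And>x y a m. \<lbrakk>x \<in> Ob C; y \<in> Ob C; a \<in> carrier k; m \<in> carrier (Mor C x y)\<rbrakk>
      \<Longrightarrow> q x y (a \<odot>\<^bsub>Mor C x y\<^esub> m) = a \<odot>\<^bsub>Mor D (p x) (p y)\<^esub> q x y m"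
  shows "k_functor k C D (mk_fun C p q)"
proof -
  interpret C: k_category k C by fact
  have mods: "module k (Mor C x y)" if "x \<in> Ob C" "y \<in> Ob C" for x y
    using C.Mor_module that .
  have add: "m \<oplus>\<^bsub>Mor C x y\<^esub> m' \<in> carrier (Mor C x y)"
    if "x \<in> Ob C" "y \<in> Ob C" "m \<in> carrier (Mor C x y)" "m' \<in> carrier (Mor C x y)" for x y m m'
    using mods[OF that(1,2)] that(3,4)
    by (meson abelian_groupE(1) module.axioms(2))
  have smult: "a \<odot>\<^bsub>Mor C x y\<^esub> m \<in> carrier (Mor C x y)"
    if "x \<in> Ob C" "y \<in> Ob C" "a \<in> carrier k" "m \<in> carrier (Mor C x y)" for x y a m
    using module.smult_closed[OF mods[OF that(1,2)]] that(3,4) .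
  have idem: "mk_fun C p q = mk_fun C (fobj (mk_fun C p q)) (fmor (mk_fun C p q))"
    by (rule mk_fun_cong) auto
  show ?thesis
    unfolding k_functor_def
    using C D idem assms(3-) by (simp add: add smult C.Idm_closed C.Cmp_closed)
qed

lemma k_functor_comp_fun:
  assumes F: "k_functor k C D F" and F': "k_functor k D E F'"
  shows "k_functor k C E (comp_fun C F' F)"
  unfolding comp_fun_def
  by (rule k_functor_mk_funI)
    (simp_all add: k_functorD(1,2,4-)[OF F] k_functorD(2,4-)[OF F'])

lemma (in k_category) Mor_abelian_group:
  "x \<in> Ob C \<Longrightarrow> y \<in> Ob C \<Longrightarrow> abelian_group (Mor C x y)"
  using Mor_module by (auto simp: module_def)

lemma k_functor_zero:
  assumes F: "k_functor k C D F" and xy: "x \<in> Ob C" "y \<in> Ob C"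
  shows "fmor F x y \<zero>\<^bsub>Mor C x y\<^esub> = \<zero>\<^bsub>Mor D (fobj F x) (fobj F y)\<^esub>"
proof -
  interpret M: abelian_group "Mor C x y"
    using k_category.Mor_abelian_group[OF k_functorD(1)[OF F] xy] .
  interpret N: abelian_group "Mor D (fobj F x) (fobj F y)"
    using k_category.Mor_abelian_group[OF k_functorD(2)[OF F]] k_functorD(4)[OF F] xy by blast
  have "fmor F x y \<zero>\<^bsub>Mor C x y\<^esub> \<in> carrier (Mor D (fobj F x) (fobj F y))"
    using k_functorD(5)[OF F xy] by simp
  then show ?thesis
    using k_functorD(8)[OF F xy, of "\<zero>\<^bsub>Mor C x y\<^esub>" "\<zero>\<^bsub>Mor C x y\<^esub>"] N.add.l_cancel_one by simp
qed

lemma k_functor_finsum: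
  assumes F: "k_functor k C D F" and xy: "x \<in> Ob C" "y \<in> Ob C"
    and "finite A" and "n \<in> A \<rightarrow> carrier (Mor C x y)"
  shows "fmor F x y (finsum (Mor C x y) n A)
    = finsum (Mor D (fobj F x) (fobj F y)) (\<lambda>a. fmor F x y (n a)) A"
proof -
  interpret M: abelian_group "Mor C x y"
    using k_category.Mor_abelian_group[OF k_functorD(1)[OF F] xy] .
  interpret N: abelian_group "Mor D (fobj F x) (fobj F y)"
    using k_category.Mor_abelian_group[OF k_functorD(2)[OF F]] k_functorD(4)[OF F] xy by blast
  show ?thesis
    using assms(4,5)
  proof (induction A)
    case empty
    then show ?case using k_functor_zero[OF F xy] by simp
  next
    case (insert a A)
    then have "(\<lambda>a. fmor F x y (n a)) \<in> A \<rightarrow> carrier (Mor D (fobj F x) (fobj F y))"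
      "fmor F x y (n a) \<in> carrier (Mor D (fobj F x) (fobj F y))"
      "finsum (Mor C x y) n A \<in> carrier (Mor C x y)"
      using k_functorD(5)[OF F xy] by auto
    then show ?case using insert k_functorD(8)[OF F xy]
      by (simp add: Pi_def M.finsum_insert N.finsum_insert)
  qed
qed

section \<open>Smash products\<close>

lemma Ob_smash [simp]: "Ob (smash B G X) = Ob B \<times> carrier G"
  by (simp add: smash_def)

lemma Mor_smash:
  "Mor (smash B G X) x y
    = (Mor B (fst x) (fst y))\<lparr>carrier := X (fst x) (fst y) (inv\<^bsub>G\<^esub> snd y \<otimes>\<^bsub>G\<^esub> snd x)\<rparr>"
  by (simp add: smash_def split_beta)

lemma Cmp_smash: "Cmp (smash B G X) x y z = Cmp B (fst x) (fst y) (fst z)"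
  by (simp add: smash_def split_beta)

lemma Idm_smash: "Idm (smash B G X) x = Idm B (fst x)"
  by (simp add: smash_def split_beta)

locale galois_smash =
  fixes k :: "('r, 'p) ring_scheme" and B :: "('o, 'r, 'm) kcat"
    and G :: "('g, 'z) monoid_scheme" and X :: "'o \<Rightarrow> 'o \<Rightarrow> 'g \<Rightarrow> 'm set"
  assumes grading: "grading k B G X"
    and galois: "galois_covering k (smash B G X) B (smash_proj B G X)"
begin

sublocale B: k_category k B using grading by (simp add: grading_def)
sublocale G: group G using grading by (simp add: grading_def)

lemma smash_proj_functor: "k_functor k (smash B G X) B (smash_proj B G X)"
  using galois by (simp add: galois_covering_def covering_def)

lemma smash_category: "k_category k (smash B G X)"
  using k_functorD(1)[OF smash_proj_functor] .

lemma smash_connected: "connected_kcat (smash B G X)"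
  using galois by (simp add: galois_covering_def)

lemma fobj_smash_proj [simp]: "x \<in> Ob (smash B G X) \<Longrightarrow> fobj (smash_proj B G X) x = fst x"
  unfolding smash_proj_def by (rule fobj_mk_fun)

lemma fmor_smash_proj [simp]:
  "\<lbrakk>x \<in> Ob (smash B G X); y \<in> Ob (smash B G X); m \<in> carrier (Mor (smash B G X) x y)\<rbrakk>
    \<Longrightarrow> fmor (smash_proj B G X) x y m = m"
  unfolding smash_proj_def by (rule fmor_mk_fun)

lemma direct: "b \<in> Ob B \<Longrightarrow> c \<in> Ob B \<Longrightarrow> internal_direct_sum k (Mor B b c) (carrier G) (X b c)"
  using grading by (simp add: grading_def)

lemma degree_unique:
  assumes "b \<in> Ob B" "c \<in> Ob B" "s \<in> carrier G" "t \<in> carrier G"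
    and "m \<in> X b c s" "m \<in> X b c t" "m \<noteq> \<zero>\<^bsub>Mor B b c\<^esub>"
  shows "s = t"
  using internal_direct_sum_degree_unique[OF B.Mor_abelian_group direct] assms by blast

text \<open>The uniqueness of lifts for the covering \<open>B#G \<rightarrow> B\<close>.  Let \<open>m\<close> be a non-zero morphism from \<open>x\<close>
  to \<open>y\<close>, and let \<open>P x\<close>, \<open>P y\<close>, \<open>Q x\<close>, \<open>Q y\<close> have group coordinates \<open>p\<^sub>x\<close>, \<open>p\<^sub>y\<close>, \<open>q\<^sub>x\<close>, \<open>q\<^sub>y\<close>.  The
  common image of \<open>m\<close> in \<open>B\<close> is non-zero and homogeneous both of degree \<open>p\<^sub>y\<^sup>-\<^sup>1 p\<^sub>x\<close> and of degree
  \<open>q\<^sub>y\<^sup>-\<^sup>1 q\<^sub>x\<close>, so \<open>p\<^sub>x = q\<^sub>x\<close> if and only if \<open>p\<^sub>y = q\<^sub>y\<close>.\<close>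

lemma smash_lifts_equal:
  assumes P: "k_functor k D (smash B G X) P" and Q: "k_functor k D (smash B G X) Q"
    and conn: "connected_kcat D"
    and proj: "comp_fun D (smash_proj B G X) P = comp_fun D (smash_proj B G X) Q"
    and nz: "\<And>x y m. \<lbrakk>x \<in> Ob D; y \<in> Ob D; m \<in> carrier (Mor D x y); m \<noteq> \<zero>\<^bsub>Mor D x y\<^esub>\<rbrakk>
      \<Longrightarrow> fmor P x y m \<noteq> \<zero>\<^bsub>Mor B (fst (fobj P x)) (fst (fobj P y))\<^esub>"
    and x0: "x0 \<in> Ob D" "fobj P x0 = fobj Q x0"
  shows "P = Q"
proof -
  note PO = k_functorD(4)[OF P] and QO = k_functorD(4)[OF Q]
  have fst_eq: "fst (fobj P x) = fst (fobj Q x)" if "x \<in> Ob D" for x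
    using arg_cong[OF proj, of "\<lambda>F. fobj F x"] that PO[OF that] QO[OF that] by (simp del: Ob_smash)
  have mor_eq: "fmor P x y m = fmor Q x y m"
    if "x \<in> Ob D" "y \<in> Ob D" "m \<in> carrier (Mor D x y)" for x y m
    using arg_cong[OF proj, of "\<lambda>F. fmor F x y m"] that PO QO
      k_functorD(5)[OF P that] k_functorD(5)[OF Q that] by (simp del: Ob_smash)
  have memP: "fmor P x y m \<in> X (fst (fobj P x)) (fst (fobj P y))
      (inv\<^bsub>G\<^esub> snd (fobj P y) \<otimes>\<^bsub>G\<^esub> snd (fobj P x))"
    if "x \<in> Ob D" "y \<in> Ob D" "m \<in> carrier (Mor D x y)" for x y m
    using k_functorD(5)[OF P that] by (simp add: Mor_smash)
  have memQ: "fmor P x y m \<in> X (fst (fobj P x)) (fst (fobj P y))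
      (inv\<^bsub>G\<^esub> snd (fobj Q y) \<otimes>\<^bsub>G\<^esub> snd (fobj Q x))"
    if "x \<in> Ob D" "y \<in> Ob D" "m \<in> carrier (Mor D x y)" for x y m
    using k_functorD(5)[OF Q that] that by (simp add: Mor_smash mor_eq fst_eq)
  have inB: "fst (fobj P x) \<in> Ob B" "snd (fobj P x) \<in> carrier G" "snd (fobj Q x) \<in> carrier G"
    if "x \<in> Ob D" for x
    using PO[OF that] QO[OF that] by auto
  have deg: "inv\<^bsub>G\<^esub> snd (fobj P y) \<otimes>\<^bsub>G\<^esub> snd (fobj P x)
      = inv\<^bsub>G\<^esub> snd (fobj Q y) \<otimes>\<^bsub>G\<^esub> snd (fobj Q x)"
    if "x \<in> Ob D" "y \<in> Ob D" "m \<in> carrier (Mor D x y)" "m \<noteq> \<zero>\<^bsub>Mor D x y\<^esub>" for x y m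
    using degree_unique[OF _ _ _ _ memP[OF that(1-3)] memQ[OF that(1-3)] nz[OF that]]
      inB[OF that(1)] inB[OF that(2)] by simp
  have agree: "y \<in> Ob D \<and> snd (fobj P y) = snd (fobj Q y)"
    if "walk_joined D x y" "fobj P x = fobj Q x" for x y
    using that
  proof (induction rule: walk_joined.induct)
    case (fwd x y z f)
    then show ?case using deg[of y z f] inB[of y] inB[of z] by auto
  next
    case (bwd x y z f)
    then show ?case using deg[of z y f] inB[of y] inB[of z] by auto
  qed simp
  show ?thesis
  proof (rule k_functor_eqI[OF P Q])
    show "fobj P x = fobj Q x" if "x \<in> Ob D" for x
    proof -
      have "walk_joined D x0 x" using conn x0(1) that unfolding connected_kcat_def by blast
      then show ?thesis using agree[OF _ x0(2)] fst_eq[OF that] by (simp add: prod_eq_iff)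
    qed
  qed (rule mor_eq)
qed

lemma Mor_smash_translate:
  assumes "u \<in> carrier G" "x \<in> Ob (smash B G X)" "y \<in> Ob (smash B G X)"
  shows "Mor (smash B G X) (fst x, u \<otimes>\<^bsub>G\<^esub> snd x) (fst y, u \<otimes>\<^bsub>G\<^esub> snd y) = Mor (smash B G X) x y"
proof -
  have "inv\<^bsub>G\<^esub> u \<otimes>\<^bsub>G\<^esub> (u \<otimes>\<^bsub>G\<^esub> snd x) = snd x"
    using assms by (auto simp flip: G.m_assoc)
  then have "inv\<^bsub>G\<^esub> (u \<otimes>\<^bsub>G\<^esub> snd y) \<otimes>\<^bsub>G\<^esub> (u \<otimes>\<^bsub>G\<^esub> snd x) = inv\<^bsub>G\<^esub> snd y \<otimes>\<^bsub>G\<^esub> snd x"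
    using assms by (auto simp: G.inv_mult_group G.m_assoc)
  then show ?thesis by (simp add: Mor_smash)
qed

lemma fobj_smash_act [simp]:
  "x \<in> Ob (smash B G X) \<Longrightarrow> fobj (smash_act B G X u) x = (fst x, u \<otimes>\<^bsub>G\<^esub> snd x)"
  unfolding smash_act_def by (subst fobj_mk_fun) (auto simp: split_beta)

lemma fmor_smash_act [simp]:
  "\<lbrakk>x \<in> Ob (smash B G X); y \<in> Ob (smash B G X); m \<in> carrier (Mor (smash B G X) x y)\<rbrakk>
    \<Longrightarrow> fmor (smash_act B G X u) x y m = m"
  unfolding smash_act_def by (rule fmor_mk_fun)

lemma smash_act_functor:
  assumes u: "u \<in> carrier G"
  shows "k_functor k (smash B G X) (smash B G X) (smash_act B G X u)"
  unfolding smash_act_def split_beta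
  by (rule k_functor_mk_funI[OF smash_category smash_category])
    (use u in \<open>auto simp: Mor_smash_translate[simplified] Cmp_smash Idm_smash\<close>)

lemma smash_act_mult:
  assumes u: "u \<in> carrier G" and v: "v \<in> carrier G"
  shows "smash_act B G X (u \<otimes>\<^bsub>G\<^esub> v)
    = comp_fun (smash B G X) (smash_act B G X u) (smash_act B G X v)"
proof (rule k_functor_eqI)
  show "k_functor k (smash B G X) (smash B G X) (smash_act B G X (u \<otimes>\<^bsub>G\<^esub> v))"
    using smash_act_functor u v by simp
  note V = smash_act_functor[OF v]
  show "k_functor k (smash B G X) (smash B G X)
      (comp_fun (smash B G X) (smash_act B G X u) (smash_act B G X v))"
    using k_functor_comp_fun[OF V smash_act_functor[OF u]] .
  show "fobj (smash_act B G X (u \<otimes>\<^bsub>G\<^esub> v)) x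
      = fobj (comp_fun (smash B G X) (smash_act B G X u) (smash_act B G X v)) x"
    if x: "x \<in> Ob (smash B G X)" for x
    unfolding fobj_comp_fun[OF x] fobj_smash_act[OF k_functorD(4)[OF V x]]
    using x u v by (auto simp: G.m_assoc)
  show "fmor (smash_act B G X (u \<otimes>\<^bsub>G\<^esub> v)) x y m
      = fmor (comp_fun (smash B G X) (smash_act B G X u) (smash_act B G X v)) x y m"
    if m: "x \<in> Ob (smash B G X)" "y \<in> Ob (smash B G X)" "m \<in> carrier (Mor (smash B G X) x y)"
    for x y m
    unfolding fmor_comp_fun[OF m]
      fmor_smash_act[OF k_functorD(4)[OF V m(1)] k_functorD(4)[OF V m(2)] k_functorD(5)[OF V m]]
    by (simp only: fmor_smash_act[OF m])
qed

lemma smash_act_one: "smash_act B G X \<one>\<^bsub>G\<^esub> = id_fun (smash B G X)"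
  unfolding smash_act_def id_fun_def by (rule mk_fun_cong) auto

lemma smash_proj_act:
  assumes u: "u \<in> carrier G"
  shows "comp_fun (smash B G X) (smash_proj B G X) (smash_act B G X u) = smash_proj B G X"
proof (rule k_functor_eqI[OF k_functor_comp_fun[OF smash_act_functor[OF u] smash_proj_functor]
      smash_proj_functor])
  note U = smash_act_functor[OF u]
  show "fobj (comp_fun (smash B G X) (smash_proj B G X) (smash_act B G X u)) x
      = fobj (smash_proj B G X) x"
    if x: "x \<in> Ob (smash B G X)" for x
    using fobj_smash_proj[OF k_functorD(4)[OF U x]]
    by (simp only: fobj_comp_fun[OF x] fobj_smash_act[OF x] fobj_smash_proj[OF x] fst_conv)
  show "fmor (comp_fun (smash B G X) (smash_proj B G X) (smash_act B G X u)) x y m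
      = fmor (smash_proj B G X) x y m"
    if m: "x \<in> Ob (smash B G X)" "y \<in> Ob (smash B G X)" "m \<in> carrier (Mor (smash B G X) x y)"
    for x y m
    unfolding fmor_comp_fun[OF m]
      fmor_smash_proj[OF k_functorD(4)[OF U m(1)] k_functorD(4)[OF U m(2)] k_functorD(5)[OF U m]]
    by (simp only: fmor_smash_act[OF m] fmor_smash_proj[OF m])
qed

lemma smash_act_in_Aut1:
  assumes u: "u \<in> carrier G"
  shows "smash_act B G X u \<in> carrier (Aut1 k (smash B G X) (smash_proj B G X))"
proof -
  have "comp_fun (smash B G X) (smash_act B G X (inv\<^bsub>G\<^esub> u)) (smash_act B G X u) = id_fun (smash B G X)"
    "comp_fun (smash B G X) (smash_act B G X u) (smash_act B G X (inv\<^bsub>G\<^esub> u)) = id_fun (smash B G X)"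
    using u by (simp_all flip: smash_act_mult smash_act_one)
  then show ?thesis
    using smash_act_functor u smash_proj_act[OF u]
    by (auto simp: Aut1_def k_functor_iso_def intro!: exI[of _ "smash_act B G X (inv\<^bsub>G\<^esub> u)"])
qed

lemma Aut1_functor:
  "f \<in> carrier (Aut1 k (smash B G X) (smash_proj B G X))
    \<Longrightarrow> k_functor k (smash B G X) (smash B G X) f"
  by (simp add: Aut1_def k_functor_iso_def)

lemma fmor_Aut1:
  assumes f: "f \<in> carrier (Aut1 k (smash B G X) (smash_proj B G X))"
    and m: "x \<in> Ob (smash B G X)" "y \<in> Ob (smash B G X)" "m \<in> carrier (Mor (smash B G X) x y)"
  shows "fmor f x y m = m"
proof -
  note F = Aut1_functor[OF f]
  have "comp_fun (smash B G X) (smash_proj B G X) f = smash_proj B G X"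
    using f by (simp add: Aut1_def)
  from arg_cong[OF this, of "\<lambda>F. fmor F x y m"] show ?thesis
    unfolding fmor_comp_fun[OF m] fmor_smash_proj[OF m]
      fmor_smash_proj[OF k_functorD(4)[OF F m(1)] k_functorD(4)[OF F m(2)] k_functorD(5)[OF F m]] .
qed

lemma fst_fobj_Aut1:
  assumes f: "f \<in> carrier (Aut1 k (smash B G X) (smash_proj B G X))" and x: "x \<in> Ob (smash B G X)"
  shows "fst (fobj f x) = fst x"
proof -
  have "comp_fun (smash B G X) (smash_proj B G X) f = smash_proj B G X"
    using f by (simp add: Aut1_def)
  from arg_cong[OF this, of "\<lambda>F. fobj F x"] show ?thesis
    unfolding fobj_comp_fun[OF x] fobj_smash_proj[OF x]
      fobj_smash_proj[OF k_functorD(4)[OF Aut1_functor[OF f] x]] .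
qed

text \<open>An automorphism over \<open>B\<close> acts as the identity on morphisms, so unique lifting applies.\<close>

lemma Aut1_eqI:
  assumes f: "f \<in> carrier (Aut1 k (smash B G X) (smash_proj B G X))"
    and f': "f' \<in> carrier (Aut1 k (smash B G X) (smash_proj B G X))"
    and x: "x \<in> Ob (smash B G X)" "fobj f x = fobj f' x"
  shows "f = f'"
proof (rule smash_lifts_equal[OF Aut1_functor[OF f] Aut1_functor[OF f'] smash_connected _ _ x])
  show "comp_fun (smash B G X) (smash_proj B G X) f = comp_fun (smash B G X) (smash_proj B G X) f'"
    using f f' by (simp add: Aut1_def)
  show "fmor f x y m \<noteq> \<zero>\<^bsub>Mor B (fst (fobj f x)) (fst (fobj f y))\<^esub>"
    if "x \<in> Ob (smash B G X)" "y \<in> Ob (smash B G X)" "m \<in> carrier (Mor (smash B G X) x y)"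
      "m \<noteq> \<zero>\<^bsub>Mor (smash B G X) x y\<^esub>" for x y m
    unfolding fmor_Aut1[OF f that(1-3)] fst_fobj_Aut1[OF f that(1)] fst_fobj_Aut1[OF f that(2)]
    using that(4) by (simp add: Mor_smash)
qed

text \<open>Surjectivity: an automorphism that maps \<open>(b, 1)\<close> to \<open>(b, u)\<close> agrees there with the action of
  \<open>u\<close>, hence everywhere.\<close>

lemma smash_act_iso:
  assumes b: "b \<in> Ob B"
  shows "smash_act B G X \<in> iso G (Aut1 k (smash B G X) (smash_proj B G X))"
proof (rule isoI)
  show "smash_act B G X \<in> hom G (Aut1 k (smash B G X) (smash_proj B G X))"
    by (rule homI) (simp_all add: smash_act_in_Aut1 smash_act_mult, simp add: Aut1_def)
  have b1: "(b, \<one>\<^bsub>G\<^esub>) \<in> Ob (smash B G X)" using b by simp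
  have at1: "fobj (smash_act B G X u) (b, \<one>\<^bsub>G\<^esub>) = (b, u)" if "u \<in> carrier G" for u
    unfolding fobj_smash_act[OF b1] using that by simp
  show "bij_betw (smash_act B G X) (carrier G) (carrier (Aut1 k (smash B G X) (smash_proj B G X)))"
    unfolding bij_betw_def
  proof
    show "inj_on (smash_act B G X) (carrier G)"
      by (rule inj_onI) (metis at1 prod.inject)
    show "smash_act B G X ` carrier G = carrier (Aut1 k (smash B G X) (smash_proj B G X))"
    proof (intro equalityI subsetI)
      fix f assume f: "f \<in> carrier (Aut1 k (smash B G X) (smash_proj B G X))"
      define u where "u = snd (fobj f (b, \<one>\<^bsub>G\<^esub>))"
      have u: "u \<in> carrier G"
        using k_functorD(4)[OF Aut1_functor[OF f] b1] by (auto simp: u_def)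
      have "f = smash_act B G X u"
        by (rule Aut1_eqI[OF f smash_act_in_Aut1[OF u] b1])
          (use fst_fobj_Aut1[OF f b1] at1[OF u] in \<open>simp add: u_def prod_eq_iff\<close>)
      then show "f \<in> smash_act B G X ` carrier G" using u by blast
    qed (use smash_act_in_Aut1 in blast)
  qed
qed

end

section \<open>Morphisms of coverings between smash products\<close>

locale smash_morphism =
  S1: galois_smash k B G1 X1 + S2: galois_smash k B G2 X2
  for k :: "('r, 'p) ring_scheme" and B :: "('o, 'r, 'm) kcat"
    and G1 :: "('g1, 'z1) monoid_scheme" and X1 :: "'o \<Rightarrow> 'o \<Rightarrow> 'g1 \<Rightarrow> 'm set"
    and G2 :: "('g2, 'z2) monoid_scheme" and X2 :: "'o \<Rightarrow> 'o \<Rightarrow> 'g2 \<Rightarrow> 'm set" +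
  fixes b0 :: 'o
    and H :: "('o \<times> 'g1, 'm, 'o \<times> 'g2, 'm) kfun" and J :: "('o, 'm, 'o, 'm) kfun"
  assumes b0: "b0 \<in> Ob B"
    and gal: "gal_morphism k B (smash B G1 X1) (smash_proj B G1 X1)
      (smash B G2 X2) (smash_proj B G2 X2) H J"
begin

abbreviation "C1 \<equiv> smash B G1 X1"
abbreviation "C2 \<equiv> smash B G2 X2"
abbreviation "F1 \<equiv> smash_proj B G1 X1"
abbreviation "F2 \<equiv> smash_proj B G2 X2"

lemma H: "k_functor k C1 C2 H"
  and J: "k_functor k B B J"
  and J_iso: "k_functor_iso k B B J"
  and J_obj: "b \<in> Ob B \<Longrightarrow> fobj J b = b"
  and square: "comp_fun C1 F2 H = comp_fun C1 J F1"
  using gal by (auto simp: gal_morphism_def k_functor_iso_def)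

lemma fst_fobj_H:
  assumes x: "x \<in> Ob C1" shows "fst (fobj H x) = fst x"
  using arg_cong[OF square, of "\<lambda>F. fobj F x"] x
  unfolding fobj_comp_fun[OF x] S1.fobj_smash_proj[OF x]
    S2.fobj_smash_proj[OF k_functorD(4)[OF H x]]
  by (auto simp: J_obj)

lemma fmor_H:
  assumes m: "x \<in> Ob C1" "y \<in> Ob C1" "m \<in> carrier (Mor C1 x y)"
  shows "fmor H x y m = fmor J (fst x) (fst y) m"
  using arg_cong[OF square, of "\<lambda>F. fmor F x y m"]
  unfolding fmor_comp_fun[OF m] S1.fmor_smash_proj[OF m] S1.fobj_smash_proj[OF m(1)]
    S1.fobj_smash_proj[OF m(2)]
    S2.fmor_smash_proj[OF k_functorD(4)[OF H m(1)] k_functorD(4)[OF H m(2)] k_functorD(5)[OF H m]] .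

lemma snd_fobj_H:
  assumes x: "x \<in> Ob C1" shows "snd (fobj H x) \<in> carrier G2"
  using k_functorD(4)[OF H x] by auto

lemma J_inverse:
  obtains J' :: "('o, 'm, 'o, 'm) kfun" where "\<And>b c m. \<lbrakk>b \<in> Ob B; c \<in> Ob B; m \<in> carrier (Mor B b c)\<rbrakk>
      \<Longrightarrow> fmor J' b c m \<in> carrier (Mor B b c)"
    and "\<And>b c m. \<lbrakk>b \<in> Ob B; c \<in> Ob B; m \<in> carrier (Mor B b c)\<rbrakk> \<Longrightarrow> fmor J b c (fmor J' b c m) = m"
    and "\<And>b c m. \<lbrakk>b \<in> Ob B; c \<in> Ob B; m \<in> carrier (Mor B b c)\<rbrakk> \<Longrightarrow> fmor J' b c (fmor J b c m) = m"
    and "\<And>b c. \<lbrakk>b \<in> Ob B; c \<in> Ob B\<rbrakk> \<Longrightarrow> fmor J' b c \<zero>\<^bsub>Mor B b c\<^esub> = \<zero>\<^bsub>Mor B b c\<^esub>"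
proof -
  obtain J' where J': "k_functor k B B J'" "comp_fun B J' J = id_fun B" "comp_fun B J J' = id_fun B"
    using J_iso by (auto simp: k_functor_iso_def)
  have obj: "fobj J' b = b" if b: "b \<in> Ob B" for b
    using arg_cong[OF J'(2), of "\<lambda>F. fobj F b"] b by (simp add: J_obj)
  show thesis
  proof (rule that[of J'])
    fix b c m assume m: "b \<in> Ob B" "c \<in> Ob B" "m \<in> carrier (Mor B b c)"
    show "fmor J' b c m \<in> carrier (Mor B b c)"
      using k_functorD(5)[OF J'(1) m] m by (simp add: obj)
    show "fmor J b c (fmor J' b c m) = m"
      using arg_cong[OF J'(3), of "\<lambda>F. fmor F b c m"] m by (simp add: obj)
    show "fmor J' b c (fmor J b c m) = m"
      using arg_cong[OF J'(2), of "\<lambda>F. fmor F b c m"] m by (simp add: J_obj)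
  next
    fix b c assume "b \<in> Ob B" "c \<in> Ob B"
    then show "fmor J' b c \<zero>\<^bsub>Mor B b c\<^esub> = \<zero>\<^bsub>Mor B b c\<^esub>"
      using k_functor_zero[OF J'(1)] by (simp add: obj)
  qed
qed

lemma J_nonzero:
  assumes "b \<in> Ob B" "c \<in> Ob B" "m \<in> carrier (Mor B b c)" "m \<noteq> \<zero>\<^bsub>Mor B b c\<^esub>"
  shows "fmor J b c m \<noteq> \<zero>\<^bsub>Mor B b c\<^esub>"
proof -
  obtain J' :: "('o, 'm, 'o, 'm) kfun" where "fmor J' b c (fmor J b c m) = m"
    "fmor J' b c \<zero>\<^bsub>Mor B b c\<^esub> = \<zero>\<^bsub>Mor B b c\<^esub>"
    using J_inverse assms(1-3) by metis
  then show ?thesis using assms(4) by metis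
qed

text \<open>The hypothesis \<open>Jd\<close> holds as soon as one end of the morphisms is fixed in \<open>B#G\<^sub>1\<close>: each component \<open>X1 b c t\<close>
  then becomes a morphism module of \<open>B#G\<^sub>1\<close>, on which \<open>H\<close> acts as \<open>J\<close>.  Decomposing \<open>J\<^sup>-\<^sup>1 m\<close> into
  \<open>X1\<close>-components and applying \<open>J\<close> writes \<open>m\<close> as a sum of \<open>X2\<close>-homogeneous elements of degrees
  \<open>d t\<close>.\<close>

lemma homogeneous_component_of_J_preimage:
  assumes bc: "b \<in> Ob B" "c \<in> Ob B" and s: "s \<in> carrier G2"
    and m: "m \<in> X2 b c s" "m \<noteq> \<zero>\<^bsub>Mor B b c\<^esub>"
    and d: "\<And>t. t \<in> carrier G1 \<Longrightarrow> d t \<in> carrier G2"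
    and Jd: "\<And>t n. t \<in> carrier G1 \<Longrightarrow> n \<in> X1 b c t \<Longrightarrow> fmor J b c n \<in> X2 b c (d t)"
  obtains t where "t \<in> carrier G1" "d t = s"
proof -
  have mB: "m \<in> carrier (Mor B b c)"
    using internal_direct_sum_subset(1)[OF S2.direct[OF bc] s] m(1) by blast
  obtain m' where m': "m' \<in> carrier (Mor B b c)" "fmor J b c m' = m"
    using J_inverse bc mB by metis
  obtain A n where A: "finite A" "A \<subseteq> carrier G1" "\<And>t. t \<in> A \<Longrightarrow> n t \<in> X1 b c t"
    "m' = finsum (Mor B b c) n A"
    using internal_direct_sum_decomposition[OF S1.direct[OF bc] m'(1)] by metis
  have "n \<in> A \<rightarrow> carrier (Mor B b c)"
    using internal_direct_sum_subset(1)[OF S1.direct[OF bc]] A(2,3) by blast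
  then have "m = finsum (Mor B b c) (\<lambda>t. fmor J b c (n t)) A"
    using k_functor_finsum[OF J bc A(1)] m'(2) A(4) bc by (simp add: J_obj)
  moreover have "d t \<in> carrier G2" "fmor J b c (n t) \<in> X2 b c (d t)" if "t \<in> A" for t
    using d Jd A(2,3) that by auto
  ultimately have "s \<in> d ` A"
    using internal_direct_sum_degree_occurs[OF S1.B.Mor_abelian_group[OF bc] S2.direct[OF bc] A(1),
        of d "\<lambda>t. fmor J b c (n t)" s m] s m by simp
  then show thesis using A(2) that by blast
qed

lemma fmor_J_degree:
  assumes "x \<in> Ob C1" "y \<in> Ob C1"
    and n: "n \<in> X1 (fst x) (fst y) (inv\<^bsub>G1\<^esub> snd y \<otimes>\<^bsub>G1\<^esub> snd x)"
  shows "fmor J (fst x) (fst y) n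
    \<in> X2 (fst x) (fst y) (inv\<^bsub>G2\<^esub> snd (fobj H y) \<otimes>\<^bsub>G2\<^esub> snd (fobj H x))"
proof -
  have "n \<in> carrier (Mor C1 x y)" using n by (simp add: Mor_smash)
  with k_functorD(5)[OF H assms(1,2) this] fmor_H[OF assms(1,2) this]
  show ?thesis using fst_fobj_H assms(1,2) by (simp add: Mor_smash del: Ob_smash)
qed

text \<open>Morphisms from \<open>x\<close> of \<open>X\<^sub>1\<close>-degree \<open>t\<close> end in \<open>y t\<close>, and \<open>J\<close> sends them to morphisms of \<open>X\<^sub>2\<close>-degree \<open>d t\<close>.  If
  \<open>d t\<close> is the degree of \<open>m\<close>, then \<open>H\<close> maps \<open>y t\<close> to \<open>z\<close>.\<close>

lemma lift_outgoing:
  assumes x: "x \<in> Ob C1" and z: "z \<in> Ob C2" and m: "m \<in> carrier (Mor C2 (fobj H x) z)"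
    and nz: "m \<noteq> \<zero>\<^bsub>Mor C2 (fobj H x) z\<^esub>"
  shows "z \<in> fobj H ` Ob C1"
proof -
  define y where "y t = (fst z, snd x \<otimes>\<^bsub>G1\<^esub> inv\<^bsub>G1\<^esub> t)" for t
  define d where "d t = inv\<^bsub>G2\<^esub> snd (fobj H (y t)) \<otimes>\<^bsub>G2\<^esub> snd (fobj H x)" for t
  have xB: "fst x \<in> Ob B" "snd x \<in> carrier G1" "fst z \<in> Ob B" "snd z \<in> carrier G2"
    using x z by auto
  have yC: "y t \<in> Ob C1" if "t \<in> carrier G1" for t using xB that by (simp add: y_def)
  have dG: "d t \<in> carrier G2" if "t \<in> carrier G1" for t
    using snd_fobj_H[OF yC[OF that]] snd_fobj_H[OF x] by (simp add: d_def)
  have Jd: "fmor J (fst x) (fst z) n \<in> X2 (fst x) (fst z) (d t)"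
    if t: "t \<in> carrier G1" and n: "n \<in> X1 (fst x) (fst z) t" for t n
  proof -
    have "inv\<^bsub>G1\<^esub> snd (y t) \<otimes>\<^bsub>G1\<^esub> snd x = t"
      using t xB by (simp add: y_def S1.G.inv_mult_group S1.G.m_assoc)
    then show ?thesis using fmor_J_degree[OF x yC[OF t], of n] n by (simp add: d_def y_def)
  qed
  have "m \<in> X2 (fst x) (fst z) (inv\<^bsub>G2\<^esub> snd z \<otimes>\<^bsub>G2\<^esub> snd (fobj H x))"
    "m \<noteq> \<zero>\<^bsub>Mor B (fst x) (fst z)\<^esub>"
    using m nz fst_fobj_H[OF x] by (simp_all add: Mor_smash)
  note m' = this
  have "inv\<^bsub>G2\<^esub> snd z \<otimes>\<^bsub>G2\<^esub> snd (fobj H x) \<in> carrier G2"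
    using xB snd_fobj_H[OF x] by simp
  from homogeneous_component_of_J_preimage[where d = d, OF xB(1,3) this m' dG Jd]
  obtain t where t: "t \<in> carrier G1" "d t = inv\<^bsub>G2\<^esub> snd z \<otimes>\<^bsub>G2\<^esub> snd (fobj H x)" by blast
  then have "inv\<^bsub>G2\<^esub> snd (fobj H (y t)) = inv\<^bsub>G2\<^esub> snd z"
    using snd_fobj_H[OF yC[OF t(1)]] snd_fobj_H[OF x] xB by (simp add: d_def)
  then have "snd (fobj H (y t)) = snd z"
    using S2.G.inv_inv snd_fobj_H[OF yC[OF t(1)]] xB(4) by metis
  then have "fobj H (y t) = z"
    using fst_fobj_H[OF yC[OF t(1)]] by (simp add: prod_eq_iff) (simp add: y_def)
  then show ?thesis using yC[OF t(1)] by blast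
qed

text \<open>The dual of the previous lemma; now \<open>y t\<close> is the start of the morphisms of \<open>X\<^sub>1\<close>-degree \<open>t\<close> that
  end in \<open>x\<close>.\<close>

lemma lift_incoming:
  assumes x: "x \<in> Ob C1" and z: "z \<in> Ob C2" and m: "m \<in> carrier (Mor C2 z (fobj H x))"
    and nz: "m \<noteq> \<zero>\<^bsub>Mor C2 z (fobj H x)\<^esub>"
  shows "z \<in> fobj H ` Ob C1"
proof -
  define y where "y t = (fst z, snd x \<otimes>\<^bsub>G1\<^esub> t)" for t
  define d where "d t = inv\<^bsub>G2\<^esub> snd (fobj H x) \<otimes>\<^bsub>G2\<^esub> snd (fobj H (y t))" for t
  have xB: "fst x \<in> Ob B" "snd x \<in> carrier G1" "fst z \<in> Ob B" "snd z \<in> carrier G2"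
    using x z by auto
  have yC: "y t \<in> Ob C1" if "t \<in> carrier G1" for t using xB that by (simp add: y_def)
  have dG: "d t \<in> carrier G2" if "t \<in> carrier G1" for t
    using snd_fobj_H[OF yC[OF that]] snd_fobj_H[OF x] by (simp add: d_def)
  have Jd: "fmor J (fst z) (fst x) n \<in> X2 (fst z) (fst x) (d t)"
    if t: "t \<in> carrier G1" and n: "n \<in> X1 (fst z) (fst x) t" for t n
  proof -
    have "inv\<^bsub>G1\<^esub> snd x \<otimes>\<^bsub>G1\<^esub> snd (y t) = t"
      using t xB by (simp add: y_def flip: S1.G.m_assoc)
    then show ?thesis using fmor_J_degree[OF yC[OF t] x, of n] n by (simp add: d_def y_def)
  qed
  have "m \<in> X2 (fst z) (fst x) (inv\<^bsub>G2\<^esub> snd (fobj H x) \<otimes>\<^bsub>G2\<^esub> snd z)"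
    "m \<noteq> \<zero>\<^bsub>Mor B (fst z) (fst x)\<^esub>"
    using m nz fst_fobj_H[OF x] by (simp_all add: Mor_smash)
  note m' = this
  have "inv\<^bsub>G2\<^esub> snd (fobj H x) \<otimes>\<^bsub>G2\<^esub> snd z \<in> carrier G2"
    using xB snd_fobj_H[OF x] by simp
  from homogeneous_component_of_J_preimage[where d = d, OF xB(3,1) this m' dG Jd]
  obtain t where t: "t \<in> carrier G1" "d t = inv\<^bsub>G2\<^esub> snd (fobj H x) \<otimes>\<^bsub>G2\<^esub> snd z" by blast
  then have "snd (fobj H (y t)) = snd z"
    using snd_fobj_H[OF yC[OF t(1)]] snd_fobj_H[OF x] xB by (simp add: d_def)
  then have "fobj H (y t) = z"
    using fst_fobj_H[OF yC[OF t(1)]] by (simp add: prod_eq_iff) (simp add: y_def)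
  then show ?thesis using yC[OF t(1)] by blast
qed

lemma base_in_C1: "g \<in> carrier G1 \<Longrightarrow> (b0, g) \<in> Ob C1"
  using b0 by simp

lemma fobj_H_surj:
  assumes z: "z \<in> Ob C2" shows "z \<in> fobj H ` Ob C1"
proof -
  \<comment> \<open>Any two objects of the connected category \<open>C2\<close> are joined by a walk, so one object in the image suffices.\<close>
  have propagate: "y \<in> fobj H ` Ob C1" if "walk_joined C2 x y" "x \<in> fobj H ` Ob C1" for x y
    using that
  proof (induction rule: walk_joined.induct)
    case (fwd x y z f)
    then show ?case using lift_outgoing by blast
  next
    case (bwd x y z f)
    then show ?case using lift_incoming by blast
  qed
  have b1: "(b0, \<one>\<^bsub>G1\<^esub>) \<in> Ob C1" by (rule base_in_C1) simp
  then have "walk_joined C2 (fobj H (b0, \<one>\<^bsub>G1\<^esub>)) z"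
    using k_functorD(4)[OF H b1] z S2.smash_connected unfolding connected_kcat_def by blast
  then show ?thesis using propagate b1 by blast
qed

definition fibre_map :: "'g1 \<Rightarrow> 'g2" where
  "fibre_map g = snd (fobj H (b0, g))"

definition induced_hom :: "'g1 \<Rightarrow> 'g2" where
  "induced_hom u = fibre_map u \<otimes>\<^bsub>G2\<^esub> inv\<^bsub>G2\<^esub> fibre_map \<one>\<^bsub>G1\<^esub>"

lemma fibre_map_closed [simp]: "g \<in> carrier G1 \<Longrightarrow> fibre_map g \<in> carrier G2"
  unfolding fibre_map_def by (rule snd_fobj_H[OF base_in_C1])

lemma induced_hom_closed [simp]: "g \<in> carrier G1 \<Longrightarrow> induced_hom g \<in> carrier G2"
  by (simp add: induced_hom_def)

lemma fobj_H_base: "g \<in> carrier G1 \<Longrightarrow> fobj H (b0, g) = (b0, fibre_map g)"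
  using fst_fobj_H[OF base_in_C1] by (simp add: fibre_map_def prod_eq_iff)

lemma fibre_map_surj: "fibre_map ` carrier G1 = carrier G2"
proof (intro equalityI subsetI)
  fix v assume "v \<in> carrier G2"
  then have "(b0, v) \<in> fobj H ` Ob C1" using fobj_H_surj b0 by simp
  then obtain x where x: "x \<in> Ob C1" "fobj H x = (b0, v)" unfolding image_iff by metis
  then have "fst x = b0" using fst_fobj_H by fastforce
  then have "v = fibre_map (snd x)" using x(2) by (metis fibre_map_def prod.collapse snd_conv)
  then show "v \<in> fibre_map ` carrier G1" using x(1) by auto
qed auto

text \<open>Both functors induce \<open>J\<close> on morphisms, and both send \<open>(b\<^sub>0, 1)\<close> to \<open>(b\<^sub>0, fibre_map u)\<close>; the
  latter is what dictates the formula for \<open>induced_hom\<close>.\<close>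

lemma H_smash_act:
  assumes u: "u \<in> carrier G1"
  shows "comp_fun C1 H (smash_act B G1 X1 u)
    = comp_fun C1 (smash_act B G2 X2 (induced_hom u)) H"
proof -
  note U = S1.smash_act_functor[OF u] and V = S2.smash_act_functor[OF induced_hom_closed[OF u]]
  have b1: "(b0, \<one>\<^bsub>G1\<^esub>) \<in> Ob C1" by (rule base_in_C1) simp
  have obj_l: "fobj (comp_fun C1 H (smash_act B G1 X1 u)) x = fobj H (fst x, u \<otimes>\<^bsub>G1\<^esub> snd x)"
    if x: "x \<in> Ob C1" for x
    by (simp only: fobj_comp_fun[OF x] S1.fobj_smash_act[OF x])
  have obj_r: "fobj (comp_fun C1 (smash_act B G2 X2 (induced_hom u)) H) x
      = (fst x, induced_hom u \<otimes>\<^bsub>G2\<^esub> snd (fobj H x))"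
    if x: "x \<in> Ob C1" for x
    using S2.fobj_smash_act[OF k_functorD(4)[OF H x]]
    by (simp only: fobj_comp_fun[OF x] fst_fobj_H[OF x])
  have mor_l: "fmor (comp_fun C1 H (smash_act B G1 X1 u)) x y m = fmor J (fst x) (fst y) m"
    if m: "x \<in> Ob C1" "y \<in> Ob C1" "m \<in> carrier (Mor C1 x y)" for x y m
    using fmor_H[OF k_functorD(4)[OF U m(1)] k_functorD(4)[OF U m(2)] k_functorD(5)[OF U m]]
    by (simp only: fmor_comp_fun[OF m] S1.fmor_smash_act[OF m] S1.fobj_smash_act[OF m(1)]
        S1.fobj_smash_act[OF m(2)] fst_conv)
  have mor_r: "fmor (comp_fun C1 (smash_act B G2 X2 (induced_hom u)) H) x y m = fmor J (fst x) (fst y) m"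
    if m: "x \<in> Ob C1" "y \<in> Ob C1" "m \<in> carrier (Mor C1 x y)" for x y m
    using S2.fmor_smash_act[OF k_functorD(4)[OF H m(1)] k_functorD(4)[OF H m(2)] k_functorD(5)[OF H m]]
    by (simp only: fmor_comp_fun[OF m] fmor_H[OF m])
  have fst_l: "fst (fobj (comp_fun C1 H (smash_act B G1 X1 u)) x) = fst x" if "x \<in> Ob C1" for x
    using fst_fobj_H[of "(fst x, u \<otimes>\<^bsub>G1\<^esub> snd x)"] that u by (auto simp: obj_l)
  note L = k_functor_comp_fun[OF U H] and R = k_functor_comp_fun[OF H V]
  show ?thesis
  proof (rule S2.smash_lifts_equal[OF L R S1.smash_connected _ _ b1])
    show "comp_fun C1 F2 (comp_fun C1 H (smash_act B G1 X1 u))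
        = comp_fun C1 F2 (comp_fun C1 (smash_act B G2 X2 (induced_hom u)) H)"
    proof (rule comp_fun_eqI)
      show "fobj F2 (fobj (comp_fun C1 H (smash_act B G1 X1 u)) x)
          = fobj F2 (fobj (comp_fun C1 (smash_act B G2 X2 (induced_hom u)) H) x)"
        if x: "x \<in> Ob C1" for x
        using k_functorD(4)[OF L x] k_functorD(4)[OF R x] fst_l[OF x] obj_r[OF x]
        by (simp del: Ob_smash fobj_comp_fun)
      show "fmor F2 (fobj (comp_fun C1 H (smash_act B G1 X1 u)) x)
            (fobj (comp_fun C1 H (smash_act B G1 X1 u)) y)
            (fmor (comp_fun C1 H (smash_act B G1 X1 u)) x y m)
          = fmor F2 (fobj (comp_fun C1 (smash_act B G2 X2 (induced_hom u)) H) x)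
            (fobj (comp_fun C1 (smash_act B G2 X2 (induced_hom u)) H) y)
            (fmor (comp_fun C1 (smash_act B G2 X2 (induced_hom u)) H) x y m)"
        if m: "x \<in> Ob C1" "y \<in> Ob C1" "m \<in> carrier (Mor C1 x y)" for x y m
        unfolding S2.fmor_smash_proj[OF k_functorD(4)[OF L m(1)] k_functorD(4)[OF L m(2)]
            k_functorD(5)[OF L m]]
          S2.fmor_smash_proj[OF k_functorD(4)[OF R m(1)] k_functorD(4)[OF R m(2)]
            k_functorD(5)[OF R m]]
        by (simp only: mor_l[OF m] mor_r[OF m])
    qed
    show "fmor (comp_fun C1 H (smash_act B G1 X1 u)) x y m
        \<noteq> \<zero>\<^bsub>Mor B (fst (fobj (comp_fun C1 H (smash_act B G1 X1 u)) x))
              (fst (fobj (comp_fun C1 H (smash_act B G1 X1 u)) y))\<^esub>"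
      if m: "x \<in> Ob C1" "y \<in> Ob C1" "m \<in> carrier (Mor C1 x y)" "m \<noteq> \<zero>\<^bsub>Mor C1 x y\<^esub>" for x y m
    proof -
      have "m \<in> carrier (Mor B (fst x) (fst y))"
        using k_functorD(5)[OF S1.smash_proj_functor m(1-3)] m(1-3) by (simp del: Ob_smash)
      moreover have "fst x \<in> Ob B" "fst y \<in> Ob B" using m by auto
      moreover have "m \<noteq> \<zero>\<^bsub>Mor B (fst x) (fst y)\<^esub>" using m(4) by (simp add: Mor_smash)
      ultimately show ?thesis
        unfolding mor_l[OF m(1-3)] fst_l[OF m(1)] fst_l[OF m(2)] using J_nonzero by blast
    qed
    show "fobj (comp_fun C1 H (smash_act B G1 X1 u)) (b0, \<one>\<^bsub>G1\<^esub>)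
        = fobj (comp_fun C1 (smash_act B G2 X2 (induced_hom u)) H) (b0, \<one>\<^bsub>G1\<^esub>)"
      unfolding obj_l[OF b1] obj_r[OF b1]
      using u by (simp add: fobj_H_base induced_hom_def S2.G.m_assoc)
  qed
qed

lemma fibre_map_mult:
  assumes u: "u \<in> carrier G1" and g: "g \<in> carrier G1"
  shows "fibre_map (u \<otimes>\<^bsub>G1\<^esub> g) = induced_hom u \<otimes>\<^bsub>G2\<^esub> fibre_map g"
proof -
  note x = base_in_C1[OF g]
  have "fobj H (b0, u \<otimes>\<^bsub>G1\<^esub> g) = fobj (smash_act B G2 X2 (induced_hom u)) (fobj H (b0, g))"
    using arg_cong[OF H_smash_act[OF u], of "\<lambda>F. fobj F (b0, g)"]
    by (simp only: fobj_comp_fun[OF x] S1.fobj_smash_act[OF x] fst_conv snd_conv)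
  also have "\<dots> = (b0, induced_hom u \<otimes>\<^bsub>G2\<^esub> fibre_map g)"
    unfolding S2.fobj_smash_act[OF k_functorD(4)[OF H x]] using g by (simp add: fobj_H_base)
  finally show ?thesis by (simp add: fibre_map_def)
qed

text \<open>Multiplicativity is equivariance of \<open>fibre_map\<close> read at \<open>v\<close> and translated back by
  \<open>fibre_map 1\<close>.\<close>

lemma induced_hom_epi: "induced_hom \<in> epi G1 G2"
proof -
  have "induced_hom (u \<otimes>\<^bsub>G1\<^esub> v) = induced_hom u \<otimes>\<^bsub>G2\<^esub> induced_hom v"
    if "u \<in> carrier G1" "v \<in> carrier G1" for u v
    using that by (simp add: induced_hom_def[of "u \<otimes>\<^bsub>G1\<^esub> v"] induced_hom_def[of v] fibre_map_mult
        S2.G.m_assoc)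
  then have hom: "induced_hom \<in> hom G1 G2" by (auto intro!: homI)
  have "v \<in> induced_hom ` carrier G1" if v: "v \<in> carrier G2" for v
  proof -
    have "v \<otimes>\<^bsub>G2\<^esub> fibre_map \<one>\<^bsub>G1\<^esub> \<in> fibre_map ` carrier G1"
      unfolding fibre_map_surj using v by simp
    then obtain u where u: "u \<in> carrier G1" "fibre_map u = v \<otimes>\<^bsub>G2\<^esub> fibre_map \<one>\<^bsub>G1\<^esub>" by force
    then have "induced_hom u = v" using v by (simp add: induced_hom_def S2.G.m_assoc)
    then show ?thesis using u(1) by blast
  qed
  then show ?thesis using hom by (auto simp: epi_def)
qed

text \<open>The map \<open>l\<close> below is \<open>induced_hom\<close> transported along \<open>G\<^sub>i \<cong> Aut\<^sub>1 F\<^sub>i\<close>.  It is the only candidate: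
  \<open>l'(f) H = H f\<close> fixes the value of \<open>l'(f)\<close> at the object \<open>H(b\<^sub>0, 1)\<close>, and an element of
  \<open>Aut\<^sub>1 F\<^sub>2\<close> is determined by one value.\<close>

lemma lambda_aut_smash_act:
  assumes u: "u \<in> carrier G1"
  shows "lambda_aut k C1 F1 C2 F2 H (smash_act B G1 X1 u) = smash_act B G2 X2 (induced_hom u)"
proof -
  let ?A1 = "Aut1 k C1 F1" and ?A2 = "Aut1 k C2 F2"
  let ?act1 = "smash_act B G1 X1" and ?act2 = "smash_act B G2 X2"
  let ?Q = "\<lambda>l. l \<in> epi ?A1 ?A2 \<and> l \<in> extensional (carrier ?A1) \<and>
    (\<forall>f\<in>carrier ?A1. comp_fun C1 H f = comp_fun C1 (l f) H)"
  have iso1: "?act1 \<in> iso G1 ?A1" and iso2: "?act2 \<in> iso G2 ?A2"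
    using S1.smash_act_iso S2.smash_act_iso b0 by auto
  have bij1: "bij_betw ?act1 (carrier G1) (carrier ?A1)" using iso1 by (simp add: iso_def)
  have surj1: "\<exists>v\<in>carrier G1. f = ?act1 v" if "f \<in> carrier ?A1" for f
    using that unfolding bij_betw_imp_surj_on[OF bij1, symmetric] image_iff .
  define i where "i = inv_into (carrier G1) ?act1"
  have i: "i (?act1 v) = v" if "v \<in> carrier G1" for v
    using bij1 that by (simp add: i_def bij_betw_def)
  define l where "l = restrict (?act2 \<circ> (induced_hom \<circ> i)) (carrier ?A1)"
  have l: "l (?act1 v) = ?act2 (induced_hom v)" if "v \<in> carrier G1" for v
    using that S1.smash_act_in_Aut1 by (simp add: l_def i)
  have "?act2 \<circ> (induced_hom \<circ> i) \<in> epi ?A1 ?A2"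
    by (intro epi_compose[OF epi_compose])
      (use iso1 iso2 induced_hom_epi S1.G.iso_set_sym[OF iso1] in \<open>auto simp: iso_iff_mon_epi i_def\<close>)
  moreover have "f \<otimes>\<^bsub>?A1\<^esub> g \<in> carrier ?A1" if fg: "f \<in> carrier ?A1" "g \<in> carrier ?A1" for f g
  proof -
    obtain u v where uv: "u \<in> carrier G1" "v \<in> carrier G1" "f = ?act1 u" "g = ?act1 v"
      using surj1[OF fg(1)] surj1[OF fg(2)] by metis
    then have "?act1 (u \<otimes>\<^bsub>G1\<^esub> v) = f \<otimes>\<^bsub>?A1\<^esub> g"
      using iso1 by (simp add: iso_def hom_mult)
    then show ?thesis using S1.smash_act_in_Aut1[OF S1.G.m_closed[OF uv(1,2)]] by simp
  qed
  ultimately have "l \<in> epi ?A1 ?A2"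
    by (simp add: epi_def hom_def l_def Pi_iff image_restrict_eq)
  moreover have "comp_fun C1 H f = comp_fun C1 (l f) H" if "f \<in> carrier ?A1" for f
  proof -
    from surj1[OF that] obtain v where "v \<in> carrier G1" "f = ?act1 v" by metis
    then show ?thesis by (simp add: l H_smash_act)
  qed
  ultimately have "?Q l" by (simp add: l_def)
  moreover have "l' = l" if l': "?Q l'" for l'
  proof (rule extensionalityI)
    show "l' \<in> extensional (carrier ?A1)" "l \<in> extensional (carrier ?A1)"
      using l' by (simp_all add: l_def)
    fix f assume f: "f \<in> carrier ?A1"
    have b1: "(b0, \<one>\<^bsub>G1\<^esub>) \<in> Ob C1" by (rule base_in_C1) simp
    have "comp_fun C1 (l' f) H = comp_fun C1 (l f) H" using l' \<open>?Q l\<close> f by metis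
    from arg_cong[OF this, of "\<lambda>F. fobj F (b0, \<one>\<^bsub>G1\<^esub>)"]
    have "fobj (l' f) (fobj H (b0, \<one>\<^bsub>G1\<^esub>)) = fobj (l f) (fobj H (b0, \<one>\<^bsub>G1\<^esub>))"
      by (simp only: fobj_comp_fun[OF b1])
    moreover have "l' f \<in> carrier ?A2" "l f \<in> carrier ?A2"
      using l' \<open>?Q l\<close> f by (auto simp: epi_def hom_def)
    ultimately show "l' f = l f"
      using S2.Aut1_eqI[OF _ _ k_functorD(4)[OF H b1]] by blast
  qed
  ultimately have "lambda_aut k C1 F1 C2 F2 H = l"
    unfolding lambda_aut_def by (rule the_equality)
  then show ?thesis using l[OF u] by simp
qed

lemma lambda_smash_eq_induced_hom:
  assumes u: "u \<in> carrier G1"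
  shows "lambda_smash k B G1 X1 G2 X2 H u = induced_hom u"
proof -
  have "inj_on (smash_act B G2 X2) (carrier G2)"
    using S2.smash_act_iso[OF b0] by (simp add: iso_def bij_betw_def)
  then show ?thesis
    unfolding lambda_smash_def lambda_aut_smash_act[OF u] using u by simp
qed

end


section \<open>Groups acting by left multiplication\<close>

lemma (in group) left_mult_hom: "left_mult G \<in> hom G (BijGroup (carrier G))"
proof (rule homI)
  have bij: "left_mult G u \<in> Bij (carrier G)" if u: "u \<in> carrier G" for u
  proof -
    have "bij_betw (\<lambda>g. u \<otimes> g) (carrier G) (carrier G)"
      by (rule bij_betw_byWitness[where f' = "\<lambda>g. inv u \<otimes> g"])
        (use u in \<open>auto simp flip: m_assoc\<close>)
    then have "bij_betw (left_mult G u) (carrier G) (carrier G)"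
      by (rule bij_betw_cong[THEN iffD1, rotated]) (simp add: left_mult_def)
    then show ?thesis by (simp add: Bij_def left_mult_def)
  qed
  then show "left_mult G u \<in> carrier (BijGroup (carrier G))" if "u \<in> carrier G" for u
    using that by (simp add: BijGroup_def)
  show "left_mult G (u \<otimes> v) = left_mult G u \<otimes>\<^bsub>BijGroup (carrier G)\<^esub> left_mult G v"
    if "u \<in> carrier G" "v \<in> carrier G" for u v
    using that bij
    by (auto simp: BijGroup_def compose_def left_mult_def m_assoc fun_eq_iff)
qed

text \<open>The map \<open>\<psi>\<close> is constrained on the carrier only, so that it may be a function like \<open>lambda_smash\<close>
  that is known there alone.\<close>

lemma group_action_left_mult_via:
  assumes "group G" and "group K" and "\<phi> \<in> hom G K"
    and "\<And>u. u \<in> carrier G \<Longrightarrow> \<psi> u = \<phi> u"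
  shows "group_action G (carrier K) (\<lambda>u. left_mult K (\<psi> u))"
proof -
  have "left_mult K \<circ> \<phi> \<in> hom G (BijGroup (carrier K))"
    using hom_compose[OF assms(3) group.left_mult_hom[OF assms(2)]] .
  then have "(\<lambda>u. left_mult K (\<psi> u)) \<in> hom G (BijGroup (carrier K))"
    using group.is_monoid[OF assms(1)] by (auto simp: hom_def Pi_iff assms(4) monoid.m_closed)
  then show ?thesis
    using assms(1) group_BijGroup
    by (simp add: group_action_def group_hom_def group_hom_axioms_def)
qed


theorem proposition2p12:
  fixes k :: "('r, 'p) ring_scheme"
    and B :: "('o, 'r, 'm) kcat"
    and G1 :: "('g1, 'z1) monoid_scheme" and X1 :: "'o \<Rightarrow> 'o \<Rightarrow> 'g1 \<Rightarrow> 'm set"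
    and G2 :: "('g2, 'z2) monoid_scheme" and X2 :: "'o \<Rightarrow> 'o \<Rightarrow> 'g2 \<Rightarrow> 'm set"
    and b0 :: 'o
    and H :: "('o \<times> 'g1, 'm, 'o \<times> 'g2, 'm) kfun" and J :: "('o, 'm, 'o, 'm) kfun"
  assumes "cring k" and "k_category k B" and "b0 \<in> Ob B"
    and "group G1" and "connected_grading k B G1 X1"
    and "group G2" and "connected_grading k B G2 X2"
    and "gal_morphism k B (smash B G1 X1) (smash_proj B G1 X1)
           (smash B G2 X2) (smash_proj B G2 X2) H J"
  shows "\<exists>h. h \<in> carrier G1 \<rightarrow> carrier G2 \<and>
    (\<forall>g\<in>carrier G1. fobj H (b0, g) = (b0, h g)) \<and>
    gset_morphism G1 (carrier G1) (left_mult G1)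
      (carrier G2) (\<lambda>u. left_mult G2 (lambda_smash k B G1 X1 G2 X2 H u)) h \<and>
    (\<forall>g\<in>carrier G1. h g = lambda_smash k B G1 X1 G2 X2 H g \<otimes>\<^bsub>G2\<^esub> h \<one>\<^bsub>G1\<^esub>)"
proof -
  interpret smash_morphism k B G1 X1 G2 X2 b0 H J
    using assms by unfold_locales (auto simp: gal_morphism_def connected_grading_def)
  let ?l = "lambda_smash k B G1 X1 G2 X2 H"
  have hom: "induced_hom \<in> hom G1 G2" using induced_hom_epi by (simp add: epi_def)
  have "group_action G1 (carrier G1) (left_mult G1)"
    by (rule group_action_left_mult_via[of G1 G1 "\<lambda>u. u" "\<lambda>u. u"])
      (use assms(4) in \<open>auto simp: hom_def\<close>)
  moreover have "group_action G1 (carrier G2) (\<lambda>u. left_mult G2 (?l u))"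
    by (rule group_action_left_mult_via[OF assms(4,6) hom lambda_smash_eq_induced_hom])
  ultimately have gset: "gset_morphism G1 (carrier G1) (left_mult G1)
      (carrier G2) (\<lambda>u. left_mult G2 (?l u)) fibre_map"
    by (auto simp: gset_morphism_def left_mult_def lambda_smash_eq_induced_hom fibre_map_mult)
  have "\<forall>g\<in>carrier G1. fibre_map g = ?l g \<otimes>\<^bsub>G2\<^esub> fibre_map \<one>\<^bsub>G1\<^esub>"
  proof
    fix g assume g: "g \<in> carrier G1"
    show "fibre_map g = ?l g \<otimes>\<^bsub>G2\<^esub> fibre_map \<one>\<^bsub>G1\<^esub>"
      using fibre_map_mult[OF g S1.G.one_closed] g by (simp add: lambda_smash_eq_induced_hom)
  qed
  moreover have "fibre_map \<in> carrier G1 \<rightarrow> carrier G2" by (rule funcsetI) (rule fibre_map_closed)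
  moreover have "\<forall>g\<in>carrier G1. fobj H (b0, g) = (b0, fibre_map g)" using fobj_H_base by blast
  ultimately show ?thesis using gset by blast
qed

end
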